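(* If the groups $G_1$ and $G_2$ have property (ET), then any amalgamated product of the form $G_1*_H G_2$ has property (ET) as well.
   Context: Groups are discrete. A trace on a group $G$ is a function $\varphi:G\to\mathbb{C}$ which is positive definite, conjugation invariant, and satisfies $\varphi(e)=1$. $\mathrm{Tr}(G)$ is the compact convex set of traces with pointwise convergence, and $\mathrm{Ch}(G)$ is its set of extreme points (characters), with the subspace topology. A group $G$ has property (ET) if the trivial character $1_G$ (constant function $1$) is an isolated point of $\mathrm{Ch}(G)$. Given a group $H$ and homomorphisms $f_i:H\to G_i$ ($i=1,2$), the amalgamated product $G_1*_H G_2$ is the quotient of the free product $G_1*G_2$ by the normal subgroup generated by all $f_1(h)f_2(h)^{-1}$, $h\in H$. *)

theory Defs
  imports "HOL-Analysis.Analysis" "HOL-Algebra.Coset"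
begin

section \<open>Traces and characters\<close>

definition positive_definite :: "('a, 'm) monoid_scheme \<Rightarrow> ('a \<Rightarrow> complex) \<Rightarrow> bool" where
  "positive_definite G \<phi> \<longleftrightarrow>
    (\<forall>(n::nat) g c. g \<in> {..<n} \<rightarrow> carrier G \<longrightarrow>
      (\<Sum>i<n. \<Sum>j<n. cnj (c i) * c j * \<phi> (inv\<^bsub>G\<^esub> g i \<otimes>\<^bsub>G\<^esub> g j)) \<in> \<real>\<^sub>\<ge>\<^sub>0)"

text \<open>Functions on \<open>carrier G\<close> are represented by elements of \<^term>\<open>extensional (carrier G)\<close>.
  As these all agree outside \<open>carrier G\<close>, the product topology that the type \<open>'a \<Rightarrow> complex\<close>
  carries induces on them the topology of pointwise convergence on \<open>carrier G\<close>.\<close>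

definition traces :: "('a, 'm) monoid_scheme \<Rightarrow> ('a \<Rightarrow> complex) set" where
  "traces G = {\<phi> \<in> extensional (carrier G).
     positive_definite G \<phi> \<and>
     (\<forall>g\<in>carrier G. \<forall>h\<in>carrier G. \<phi> (h \<otimes>\<^bsub>G\<^esub> g \<otimes>\<^bsub>G\<^esub> inv\<^bsub>G\<^esub> h) = \<phi> g) \<and>
     \<phi> \<one>\<^bsub>G\<^esub> = 1}"

text \<open>Extreme points of \<^term>\<open>traces G\<close>, spelled out because \<open>'a \<Rightarrow> complex\<close> is not an instance
  of \<^class>\<open>real_vector\<close>, as \<^const>\<open>extreme_point_of\<close> requires.\<close>

definition characters :: "('a, 'm) monoid_scheme \<Rightarrow> ('a \<Rightarrow> complex) set" where
  "characters G = {\<phi> \<in> traces G.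
     \<forall>\<phi>1\<in>traces G. \<forall>\<phi>2\<in>traces G. \<forall>t::real. 0 < t \<and> t < 1 \<and>
       (\<forall>g\<in>carrier G. \<phi> g = of_real (1 - t) * \<phi>1 g + of_real t * \<phi>2 g) \<longrightarrow> \<phi>1 = \<phi>2}"

definition trivial_character :: "('a, 'm) monoid_scheme \<Rightarrow> 'a \<Rightarrow> complex" where
  "trivial_character G = (\<lambda>g\<in>carrier G. 1)"

definition property_ET :: "('a, 'm) monoid_scheme \<Rightarrow> bool" where
  "property_ET G \<longleftrightarrow> trivial_character G isolated_in characters G"


section \<open>Free products and amalgamated products\<close>

text \<open>The free product consists of the words in the disjoint union of the two carriers modulo the
  congruence generated by multiplying adjacent letters from the same factor and deleting
  identities.\<close>

definition fp_words :: "('a, 'm) monoid_scheme \<Rightarrow> ('b, 'n) monoid_scheme \<Rightarrow> ('a + 'b) list set"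
  where "fp_words G1 G2 = lists (carrier G1 <+> carrier G2)"

inductive fp_step ::
    "('a, 'm) monoid_scheme \<Rightarrow> ('b, 'n) monoid_scheme \<Rightarrow> ('a + 'b) list \<Rightarrow> ('a + 'b) list \<Rightarrow> bool"
  for G1 G2 where
  one_left: "fp_step G1 G2 (u @ [Inl \<one>\<^bsub>G1\<^esub>] @ v) (u @ v)"
| one_right: "fp_step G1 G2 (u @ [Inr \<one>\<^bsub>G2\<^esub>] @ v) (u @ v)"
| mult_left: "\<lbrakk>x \<in> carrier G1; y \<in> carrier G1\<rbrakk> \<Longrightarrow>
    fp_step G1 G2 (u @ [Inl x, Inl y] @ v) (u @ [Inl (x \<otimes>\<^bsub>G1\<^esub> y)] @ v)"
| mult_right: "\<lbrakk>x \<in> carrier G2; y \<in> carrier G2\<rbrakk> \<Longrightarrow>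
    fp_step G1 G2 (u @ [Inr x, Inr y] @ v) (u @ [Inr (x \<otimes>\<^bsub>G2\<^esub> y)] @ v)"

definition fp_rel ::
    "('a, 'm) monoid_scheme \<Rightarrow> ('b, 'n) monoid_scheme \<Rightarrow> (('a + 'b) list \<times> ('a + 'b) list) set" where
  "fp_rel G1 G2 =
    {(u, v). u \<in> fp_words G1 G2 \<and> v \<in> fp_words G1 G2 \<and>
      equivclp (\<lambda>u v. u \<in> fp_words G1 G2 \<and> v \<in> fp_words G1 G2 \<and> fp_step G1 G2 u v) u v}"

definition free_product ::
    "('a, 'm) monoid_scheme \<Rightarrow> ('b, 'n) monoid_scheme \<Rightarrow> ('a + 'b) list set monoid" where
  "free_product G1 G2 =
    \<lparr>carrier = fp_words G1 G2 // fp_rel G1 G2,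
     mult = (\<lambda>A B. \<Union>u\<in>A. \<Union>v\<in>B. fp_rel G1 G2 `` {u @ v}),
     one = fp_rel G1 G2 `` {[]}\<rparr>"

definition fp_left ::
    "('a, 'm) monoid_scheme \<Rightarrow> ('b, 'n) monoid_scheme \<Rightarrow> 'a \<Rightarrow> ('a + 'b) list set" where
  "fp_left G1 G2 x = fp_rel G1 G2 `` {[Inl x]}"

definition fp_right ::
    "('a, 'm) monoid_scheme \<Rightarrow> ('b, 'n) monoid_scheme \<Rightarrow> 'b \<Rightarrow> ('a + 'b) list set" where
  "fp_right G1 G2 y = fp_rel G1 G2 `` {[Inr y]}"

definition normal_closure :: "('a, 'm) monoid_scheme \<Rightarrow> 'a set \<Rightarrow> 'a set" where
  "normal_closure G S = (\<lambda>N. N \<lhd> G) hull S"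

definition amalgamated_product ::
    "('a, 'm) monoid_scheme \<Rightarrow> ('b, 'n) monoid_scheme \<Rightarrow> ('c, 'k) monoid_scheme \<Rightarrow>
     ('c \<Rightarrow> 'a) \<Rightarrow> ('c \<Rightarrow> 'b) \<Rightarrow> ('a + 'b) list set set monoid" where
  "amalgamated_product G1 G2 H f1 f2 =
    (let P = free_product G1 G2 in
      P Mod normal_closure P
        ((\<lambda>h. fp_left G1 G2 (f1 h) \<otimes>\<^bsub>P\<^esub> inv\<^bsub>P\<^esub> fp_right G1 G2 (f2 h)) ` carrier H))"

end

theory Submission
  imports Defs "HOL-Library.Poly_Mapping"
begin

text \<open>Say that a function \<open>\<phi>\<close> on a group has trivial part at least \<open>l\<close> on a subset \<open>X\<close> if \<open>\<phi> - l\<close> is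
  still positive definite on \<open>X\<close>. The theorem rests on three facts about this notion.

  First, property (ET) is quantitative. If \<open>1\<close> is isolated among the characters of \<open>G\<close>, there are a
  finite set \<open>K\<close> and some \<open>\<kappa> > 0\<close> with \<open>f(\<xi>) = (\<Sum>g\<in>K. 1 - Re (\<xi> g)) \<ge> \<kappa>\<close> for all characters \<open>\<xi> \<noteq> 1\<close>.
  A continuous affine function on the compact set of traces attains its minimum at an extreme
  point, so inequalities between such functions need only be checked on characters; in this way
  every trace \<open>\<phi>\<close> has trivial part at least \<open>1 - f(\<phi>)/\<kappa>\<close> on \<open>G\<close> (\<open>ET_trivial_part\<close>).

  Second, let \<open>G\<close> be generated by two subgroups on which a trace \<open>\<phi>\<close> of \<open>G\<close> has trivial parts at
  least \<open>l\<^sub>1\<close> and \<open>l\<^sub>2\<close>. In the von Neumann algebra generated by the GNS representation of \<open>\<phi>\<close>, the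
  projections \<open>P\<close>, \<open>Q\<close> onto the vectors invariant under the two subgroups have trace at least \<open>l\<^sub>1\<close>
  and \<open>l\<^sub>2\<close>. As the trace is finite, \<open>\<tau>(P \<and> Q) \<ge> \<tau>(P) + \<tau>(Q) - 1\<close>, and the range of \<open>P \<and> Q\<close> consists
  of \<open>G\<close>-invariant vectors. So \<open>\<phi>\<close> has a positive trivial part on all of \<open>G\<close> when \<open>l\<^sub>1 + l\<^sub>2 > 1\<close>
  (\<open>trivial_part_of_generated\<close>).

  Third, a character with a positive trivial part on \<open>G\<close> is a proper convex combination of \<open>1\<close>
  and a trace, so by extremality it equals \<open>1\<close> (\<open>character_eq_trivial\<close>).

  A character of the amalgamated product that is close to \<open>1\<close> on the images of the finite sets
  \<open>K\<^sub>1\<close>, \<open>K\<^sub>2\<close> of the two factors has trivial parts larger than \<open>2/3\<close> on the images of the factors.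
  These images generate, so the character is \<open>1\<close>.

  The second fact is proved without completing anything. Weak limits are replaced by explicit
  approximations in an algebra with a tracial functional, and the inequality for \<open>\<tau>(P \<and> Q)\<close> comes from
  an algebraic identity: for projections \<open>P\<close>, \<open>Q\<close>, the elements \<open>w = P + Q - 1\<close> and \<open>v = P - Q\<close> satisfy
  \<open>w\<^sup>2 + v\<^sup>2 = 1\<close> and \<open>w v = - v w\<close>. Hence \<open>\<tau>(w\<^sup>m v\<^sup>2) = 0\<close> for odd \<open>m\<close>, all odd powers of \<open>w\<close> have the
  trace \<open>\<tau>(P) + \<tau>(Q) - 1\<close>, and the means of the powers of \<open>w\<close> approach the projection onto the
  vectors fixed by \<open>w\<close>, that is, by both \<open>P\<close> and \<open>Q\<close>.\<close>


section \<open>Affine functions attain their minimum at extreme points\<close>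

definition convex_comb :: "real \<Rightarrow> ('a \<Rightarrow> complex) \<Rightarrow> ('a \<Rightarrow> complex) \<Rightarrow> ('a \<Rightarrow> complex) \<Rightarrow> bool" where
  "convex_comb t \<phi> \<phi>1 \<phi>2 \<longleftrightarrow> 0 < t \<and> t < 1 \<and> (\<forall>x. \<phi> x = of_real (1 - t) * \<phi>1 x + of_real t * \<phi>2 x)"

text \<open>Extreme points of \<open>S\<close> are the points that form an extreme subset on their own.\<close>

definition extreme_subset :: "('a \<Rightarrow> complex) set \<Rightarrow> ('a \<Rightarrow> complex) set \<Rightarrow> bool" where
  "extreme_subset S F \<longleftrightarrow> F \<subseteq> S \<and>
     (\<forall>\<phi>\<in>F. \<forall>\<phi>1\<in>S. \<forall>\<phi>2\<in>S. \<forall>t. convex_comb t \<phi> \<phi>1 \<phi>2 \<longrightarrow> \<phi>1 \<in> F \<and> \<phi>2 \<in> F)"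

lemma extreme_subset_subset: "extreme_subset S F \<Longrightarrow> F \<subseteq> S"
  unfolding extreme_subset_def by (rule conjunct1)

text \<open>Affinity is required on all functions rather than on a convex set only, because the functionals
  used below are finite combinations of coordinates.\<close>

definition affine_functional :: "(('a \<Rightarrow> complex) \<Rightarrow> real) \<Rightarrow> bool" where
  "affine_functional A \<longleftrightarrow> continuous_on UNIV A \<and>
     (\<forall>t \<phi> \<phi>1 \<phi>2. convex_comb t \<phi> \<phi>1 \<phi>2 \<longrightarrow> A \<phi> = (1 - t) * A \<phi>1 + t * A \<phi>2)"

lemma affine_functionalD:
  "affine_functional A \<Longrightarrow> convex_comb t \<phi> \<phi>1 \<phi>2 \<Longrightarrow> A \<phi> = (1 - t) * A \<phi>1 + t * A \<phi>2"
  by (auto simp: affine_functional_def)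

lemma argmin_extreme_subset:
  assumes F: "extreme_subset S F" "closed F" "F \<noteq> {}" and "compact S" and A: "affine_functional A"
  obtains F' where "extreme_subset S F'" and "closed F'" and "F' \<noteq> {}" and "F' \<subseteq> F"
    and "\<forall>\<phi>\<in>F'. \<forall>\<psi>\<in>F. A \<phi> \<le> A \<psi>"
proof -
  have FS: "F \<subseteq> S"
    using F(1) by (rule extreme_subset_subset)
  then have "compact F"
    using assms(4) F(2) by (metis closed_Int_compact inf.absorb_iff1)
  moreover have cont: "continuous_on UNIV A"
    using A by (simp add: affine_functional_def)
  ultimately obtain m where m: "m \<in> F" "\<And>\<psi>. \<psi> \<in> F \<Longrightarrow> A m \<le> A \<psi>"
    using F(3) continuous_attains_inf[of F A] continuous_on_subset by blast
  let ?F' = "{\<phi> \<in> F. A \<phi> \<le> A m}"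
  have eq: "?F' = F \<inter> {\<phi>. A \<phi> \<le> A m}" by blast
  have clo: "closed ?F'"
    unfolding eq using F(2) cont by (intro closed_Int closed_Collect_le) simp_all
  have "extreme_subset S ?F'"
    unfolding extreme_subset_def
  proof (intro conjI ballI allI impI)
    fix \<phi> \<phi>1 \<phi>2 t
    assume \<phi>: "\<phi> \<in> ?F'" "\<phi>1 \<in> S" "\<phi>2 \<in> S" and btw: "convex_comb t \<phi> \<phi>1 \<phi>2"
    then have in_F: "\<phi>1 \<in> F" "\<phi>2 \<in> F"
      using F(1) unfolding extreme_subset_def by blast+
    have t: "0 < t" "t < 1" using btw by (auto simp: convex_comb_def)
    have sum: "(1 - t) * (A \<phi>1 - A m) + t * (A \<phi>2 - A m) \<le> 0"
      using \<phi> affine_functionalD[OF A btw] by (simp add: algebra_simps)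
    have "0 \<le> (1 - t) * (A \<phi>1 - A m)" "0 \<le> t * (A \<phi>2 - A m)"
      using t in_F m(2) by simp_all
    then have "(1 - t) * (A \<phi>1 - A m) \<le> 0" "t * (A \<phi>2 - A m) \<le> 0"
      using sum by linarith+
    then have "A \<phi>1 \<le> A m" "A \<phi>2 \<le> A m"
      using t by (simp_all add: mult_le_0_iff)
    then show "\<phi>1 \<in> ?F'" "\<phi>2 \<in> ?F'"
      using in_F by simp_all
  qed (use FS in blast)
  moreover have "m \<in> ?F'" using m by simp
  ultimately show ?thesis
    using that[of ?F'] clo m(2) order_trans by blast
qed

lemma affine_coordinate:
  "affine_functional (\<lambda>\<phi>. Re (c * \<phi> x))"
  unfolding affine_functional_def
proof (intro conjI allI impI)
  show "continuous_on UNIV (\<lambda>\<phi>. Re (c * \<phi> x))"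
    by (intro continuous_intros continuous_on_product_then_coordinatewise continuous_on_id)
next
  fix t \<phi> \<phi>1 \<phi>2 assume "convex_comb t \<phi> \<phi>1 (\<phi>2 :: 'a \<Rightarrow> complex)"
  then have \<phi>: "\<phi> x = of_real (1 - t) * \<phi>1 x + of_real t * \<phi>2 x"
    by (simp add: convex_comb_def)
  have "c * \<phi> x = of_real (1 - t) * (c * \<phi>1 x) + of_real t * (c * \<phi>2 x)"
    unfolding \<phi> by (simp add: algebra_simps)
  then show "Re (c * \<phi> x) = (1 - t) * Re (c * \<phi>1 x) + t * Re (c * \<phi>2 x)"
    by simp
qed

text \<open>Zorn's lemma for the closed non-empty extreme subsets, ordered by reverse inclusion: the
  intersection of a chain is non-empty by compactness. Complements turn this into an inclusion-ordered family.\<close>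

lemma minimal_closed_extreme_subset:
  assumes "compact S" and "extreme_subset S F0" and "closed F0" and "F0 \<noteq> {}"
  obtains F where "extreme_subset S F" and "closed F" and "F \<noteq> {}" and "F \<subseteq> F0"
    and "\<And>F'. extreme_subset S F' \<Longrightarrow> closed F' \<Longrightarrow> F' \<noteq> {} \<Longrightarrow> F' \<subseteq> F \<Longrightarrow> F' = F"
proof -
  define \<F> where "\<F> = {F. extreme_subset S F \<and> closed F \<and> F \<noteq> {} \<and> F \<subseteq> F0}"
  have "\<exists>M\<in>uminus ` \<F>. \<forall>X\<in>uminus ` \<F>. M \<subseteq> X \<longrightarrow> X = M"
  proof (rule subset_Zorn_nonempty)
    show "uminus ` \<F> \<noteq> {}" using assms by (auto simp: \<F>_def)
    fix \<C> assume ne: "\<C> \<noteq> {}" and chain: "subset.chain (uminus ` \<F>) \<C>"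
    define \<D> where "\<D> = uminus ` \<C>"
    have \<D>: "\<D> \<subseteq> \<F>" "\<D> \<noteq> {}"
      using chain ne by (auto simp: \<D>_def subset_chain_def)
    have total: "X \<subseteq> Y \<or> Y \<subseteq> X" if "X \<in> \<D>" "Y \<in> \<D>" for X Y
    proof -
      have "- X \<in> \<C>" "- Y \<in> \<C>" using that by (auto simp: \<D>_def)
      then have "- X \<subseteq> - Y \<or> - Y \<subseteq> - X" using chain unfolding subset_chain_def by blast
      then show ?thesis by blast
    qed
    have sub: "F \<subseteq> S" "closed F" "F \<noteq> {}" "F \<subseteq> F0" if "F \<in> \<D>" for F
    proof -
      have "F \<in> \<F>" using that \<D> by blast
      then show "F \<subseteq> S" "closed F" "F \<noteq> {}" "F \<subseteq> F0"
        by (simp_all add: \<F>_def extreme_subset_subset)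
    qed
    have "S \<inter> \<Inter>\<D> \<noteq> {}"
    proof (rule compact_imp_fip[OF assms(1)])
      fix \<G> assume "finite \<G>" "\<G> \<subseteq> \<D>"
      then have "\<G> = {} \<or> \<Inter>\<G> \<in> \<G>"
      proof (induction rule: finite_induct)
        case (insert X \<G>)
        show ?case
        proof (cases "\<G> = {}")
          case False
          then have "\<Inter>\<G> \<in> \<D>" using insert by blast
          then have "X \<subseteq> \<Inter>\<G> \<or> \<Inter>\<G> \<subseteq> X" using total insert.prems by blast
          then have "X \<inter> \<Inter>\<G> = X \<or> X \<inter> \<Inter>\<G> = \<Inter>\<G>" by blast
          then show ?thesis using insert False by auto
        qed simp
      qed simp
      moreover have "S \<noteq> {}" using assms extreme_subset_subset by blast
      moreover have "S \<inter> G \<noteq> {}" if "G \<in> \<D>" for G using sub[OF that] by blast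
      ultimately show "S \<inter> \<Inter>\<G> \<noteq> {}"
        using \<open>\<G> \<subseteq> \<D>\<close> by (metis Inter_empty inf_top.right_neutral subset_iff)
    qed (use sub in blast)
    then have "\<Inter>\<D> \<noteq> {}" by blast
    moreover have "extreme_subset S (\<Inter>\<D>)"
    proof -
      have "\<And>F. F \<in> \<D> \<Longrightarrow> extreme_subset S F" using \<D> by (auto simp: \<F>_def)
      then show ?thesis using \<D>(2) unfolding extreme_subset_def by blast
    qed
    moreover have "closed (\<Inter>\<D>)" using sub by blast
    moreover have "\<Inter>\<D> \<subseteq> F0" using sub \<D>(2) by blast
    ultimately have "\<Inter>\<D> \<in> \<F>" by (simp add: \<F>_def)
    moreover have "\<Union>\<C> = - \<Inter>\<D>" by (auto simp: \<D>_def)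
    ultimately show "\<Union>\<C> \<in> uminus ` \<F>" by blast
  qed
  then obtain F where F: "F \<in> \<F>" and max: "\<forall>X\<in>uminus ` \<F>. - F \<subseteq> X \<longrightarrow> X = - F"
    by (elim bexE imageE) simp
  have min: "X = F" if "X \<in> \<F>" "X \<subseteq> F" for X
  proof -
    have "- X = - F"
      using max that by (meson Compl_subset_Compl_iff imageI)
    then show ?thesis by (simp only: compl_eq_compl_iff)
  qed
  show ?thesis
  proof (rule that[of F])
    show "extreme_subset S F" "closed F" "F \<noteq> {}" "F \<subseteq> F0"
      using F by (simp_all add: \<F>_def)
    show "F' = F" if "extreme_subset S F'" "closed F'" "F' \<noteq> {}" "F' \<subseteq> F" for F'
      using that F by (intro min) (auto simp: \<F>_def)
  qed
qed

text \<open>The form of the Krein-Milman theorem that is needed here. A minimal closed extreme subset of the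
  set of minimizers is a single point: otherwise a coordinate would separate two of its points, and
  minimizing that coordinate would give a smaller one.\<close>

theorem affine_minimum_at_extreme_point:
  assumes "compact S" and "closed S" and "S \<noteq> {}" and A: "affine_functional A"
  obtains \<xi> where "\<xi> \<in> S" and "extreme_subset S {\<xi>}" and "\<forall>\<phi>\<in>S. A \<xi> \<le> A \<phi>"
proof -
  have "extreme_subset S S" unfolding extreme_subset_def by blast
  then obtain F0 where F0: "extreme_subset S F0" "closed F0" "F0 \<noteq> {}" "F0 \<subseteq> S"
      "\<forall>\<phi>\<in>F0. \<forall>\<psi>\<in>S. A \<phi> \<le> A \<psi>"
    using argmin_extreme_subset[OF _ _ \<open>S \<noteq> {}\<close> \<open>compact S\<close> A] \<open>closed S\<close> by metis
  obtain F where F: "extreme_subset S F" "closed F" "F \<noteq> {}" "F \<subseteq> F0"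
    and min: "\<And>F'. extreme_subset S F' \<Longrightarrow> closed F' \<Longrightarrow> F' \<noteq> {} \<Longrightarrow> F' \<subseteq> F \<Longrightarrow> F' = F"
    using minimal_closed_extreme_subset[OF \<open>compact S\<close> F0(1-3)] by metis
  obtain \<xi> where \<xi>: "\<xi> \<in> F" using F(3) by blast
  have le: "Re (c * \<phi> x) \<le> Re (c * \<psi> x)" if "\<phi> \<in> F" "\<psi> \<in> F" for c x \<phi> \<psi>
  proof -
    obtain F' where "extreme_subset S F'" "closed F'" "F' \<noteq> {}" "F' \<subseteq> F"
      and F': "\<forall>\<phi>\<in>F'. \<forall>\<psi>\<in>F. Re (c * \<phi> x) \<le> Re (c * \<psi> x)"
      using argmin_extreme_subset[OF F(1-3) \<open>compact S\<close> affine_coordinate[of c x]] .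
    then have "F' = F" using min by blast
    then show ?thesis using F' that by blast
  qed
  have "\<phi> = \<xi>" if "\<phi> \<in> F" for \<phi>
  proof
    fix x
    show "\<phi> x = \<xi> x"
      using le[OF that \<xi>, of 1 x] le[OF \<xi> that, of 1 x] le[OF that \<xi>, of \<i> x] le[OF \<xi> that, of \<i> x]
      by (simp add: complex_eq_iff)
  qed
  then have "F = {\<xi>}" using \<xi> by blast
  then show ?thesis
    using that[of \<xi>] F F0 \<xi> by blast
qed

section \<open>Tracial algebras and almost invariant elements\<close>

text \<open>A complex \<open>*\<close>-algebra with a tracial state. The scalars enter through the central embedding
  \<open>scal\<close>, so that the carrier only needs to be a ring. The state may have a kernel: relations between elements are
  used only in the seminorm \<open>nrm a = sqrt (\<tau> (a* a))\<close>.\<close>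

locale tracial_star_algebra =
  fixes star :: "'r::ring_1 \<Rightarrow> 'r" and scal :: "complex \<Rightarrow> 'r" and \<tau> :: "'r \<Rightarrow> complex"
  assumes star_add: "star (a + b) = star a + star b"
    and star_mult: "star (a * b) = star b * star a"
    and star_star [simp]: "star (star a) = a"
    and star_scal: "star (scal c) = scal (cnj c)"
    and scal_add: "scal (c + d) = scal c + scal d"
    and scal_mult: "scal (c * d) = scal c * scal d"
    and scal_one [simp]: "scal 1 = 1"
    and scal_commute: "scal c * a = a * scal c"
    and tau_add: "\<tau> (a + b) = \<tau> a + \<tau> b"
    and tau_scal: "\<tau> (scal c * a) = c * \<tau> a"
    and tau_commute: "\<tau> (a * b) = \<tau> (b * a)"
    and tau_star: "\<tau> (star a) = cnj (\<tau> a)"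
    and tau_nonneg: "0 \<le> Re (\<tau> (star a * a))"
    and tau_one [simp]: "\<tau> 1 = 1"
begin

lemma star_zero [simp]: "star 0 = 0"
  using star_add[of 0 0] by simp

lemma star_one [simp]: "star 1 = 1"
  using star_scal[of 1] by simp

lemma star_minus: "star (- a) = - star a"
  using star_add[of a "- a"] by (simp add: eq_neg_iff_add_eq_0 add.commute)

lemma star_diff: "star (a - b) = star a - star b"
  using star_add[of a "- b"] by (simp add: star_minus)

lemma star_power: "star (a ^ n) = star a ^ n"
  by (induction n) (simp_all add: star_mult power_commutes)

lemma scal_zero [simp]: "scal 0 = 0"
  using scal_add[of 0 0] by simp

lemma scal_sum: "scal (sum c I) = (\<Sum>i\<in>I. scal (c i))"
  by (induction I rule: infinite_finite_induct) (simp_all add: scal_add)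

lemma tau_zero [simp]: "\<tau> 0 = 0"
  using tau_add[of 0 0] by simp

lemma tau_minus: "\<tau> (- a) = - \<tau> a"
  using tau_add[of a "- a"] by (simp add: eq_neg_iff_add_eq_0 add.commute)

lemma tau_diff: "\<tau> (a - b) = \<tau> a - \<tau> b"
  using tau_add[of a "- b"] by (simp add: tau_minus)

lemma tau_sum: "\<tau> (sum x I) = (\<Sum>i\<in>I. \<tau> (x i))"
  by (induction I rule: infinite_finite_induct) (simp_all add: tau_add)

definition nrm :: "'r \<Rightarrow> real" where
  "nrm a = sqrt (Re (\<tau> (star a * a)))"

lemma nrm_nonneg [simp]: "0 \<le> nrm a"
  by (simp add: nrm_def tau_nonneg)

lemma nrm_power2: "(nrm a)\<^sup>2 = Re (\<tau> (star a * a))"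
  by (simp add: nrm_def tau_nonneg)

lemma tau_star_mult_self: "\<tau> (star a * a) = of_real ((nrm a)\<^sup>2)"
proof -
  have "cnj (\<tau> (star a * a)) = \<tau> (star a * a)"
    using tau_star[of "star a * a"] by (simp add: star_mult)
  then show ?thesis
    by (simp add: nrm_power2 complex_eq_iff)
qed

lemma nrm_one [simp]: "nrm 1 = 1"
  by (simp add: nrm_def)

lemma nrm_zero [simp]: "nrm 0 = 0"
  by (simp add: nrm_def)

lemma nrm_star [simp]: "nrm (star a) = nrm a"
  by (simp add: nrm_def tau_commute)

lemma nrm_minus [simp]: "nrm (- a) = nrm a"
  by (simp add: nrm_def star_minus)

lemma nrm_scal: "nrm (scal c * a) = cmod c * nrm a"
proof -
  have "star (scal c * a) * (scal c * a) = star a * scal (cnj c) * scal c * a"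
    by (simp add: star_mult star_scal mult.assoc)
  also have "\<dots> = scal (cnj c * c) * (star a * a)"
    by (metis mult.assoc scal_commute scal_mult)
  finally have "star (scal c * a) * (scal c * a) = scal (cnj c * c) * (star a * a)" .
  then have "\<tau> (star (scal c * a) * (scal c * a)) = (cnj c * c) * \<tau> (star a * a)"
    by (simp add: tau_scal)
  also have "cnj c * c = of_real ((cmod c)\<^sup>2)"
    by (metis complex_norm_square mult.commute)
  finally show ?thesis
    by (simp add: nrm_def real_sqrt_mult)
qed

lemma nrm_add_power2: "(nrm (a + b))\<^sup>2 = (nrm a)\<^sup>2 + (nrm b)\<^sup>2 + 2 * Re (\<tau> (star a * b))"
proof -
  have "\<tau> (star b * a) = cnj (\<tau> (star a * b))"
    using tau_star[of "star a * b"] by (simp add: star_mult)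
  then show ?thesis
    by (simp add: nrm_power2 star_add tau_add distrib_left distrib_right)
qed

lemma nrm_diff_power2: "(nrm (a - b))\<^sup>2 = (nrm a)\<^sup>2 + (nrm b)\<^sup>2 - 2 * Re (\<tau> (star a * b))"
  using nrm_add_power2[of a "- b"] by (simp add: tau_minus)

lemma parallelogram: "(nrm (a + b))\<^sup>2 + (nrm (a - b))\<^sup>2 = 2 * (nrm a)\<^sup>2 + 2 * (nrm b)\<^sup>2"
  by (simp add: nrm_add_power2 nrm_diff_power2)

text \<open>The square of the seminorm of \<open>b - s \<tau>(a* b) a\<close> is a real quadratic polynomial in \<open>s\<close> without negative values.\<close>

lemma Cauchy_Schwarz: "cmod (\<tau> (star a * b)) \<le> nrm a * nrm b"
proof -
  define t where "t = \<tau> (star a * b)"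
  define T where "T = (cmod t)\<^sup>2"
  have key: "0 \<le> s\<^sup>2 * T * (nrm a)\<^sup>2 + (nrm b)\<^sup>2 - 2 * s * T" for s :: real
  proof -
    \<comment> \<open>The phase of this scalar makes the mixed term real.\<close>
    let ?x = "- of_real s * t"
    have "star (scal ?x * a) * b = scal (cnj ?x) * (star a * b)"
      by (metis mult.assoc scal_commute star_mult star_scal)
    then have "\<tau> (star (scal ?x * a) * b) = cnj ?x * t"
      by (simp add: t_def tau_scal)
    also have "\<dots> = - of_real (s * T)"
      by (simp add: T_def mult.commute flip: complex_norm_square)
    finally have "Re (\<tau> (star (scal ?x * a) * b)) = - s * T"
      by simp
    moreover have "(nrm (scal ?x * a))\<^sup>2 = s\<^sup>2 * T * (nrm a)\<^sup>2"
      by (simp add: nrm_scal T_def power_mult_distrib norm_mult)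
    ultimately show ?thesis
      using nrm_add_power2[of "scal ?x * a" b] zero_le_power2[of "nrm (scal ?x * a + b)"]
      by simp
  qed
  have "T \<le> (nrm a)\<^sup>2 * (nrm b)\<^sup>2"
  proof (cases "nrm a = 0")
    case True
    have "T = 0"
    proof (rule ccontr)
      assume "T \<noteq> 0"
      then have "T > 0" by (simp add: T_def)
      then show False
        \<comment> \<open>For this value of \<open>s\<close> the polynomial, now linear, takes the value \<open>-1\<close>.\<close>
        using key[of "((nrm b)\<^sup>2 + 1) / (2 * T)"] True by simp
    qed
    then show ?thesis by simp
  next
    case False
    then have "(nrm a)\<^sup>2 > 0" by simp
    then show ?thesis
      \<comment> \<open>The minimum of the quadratic polynomial is attained here.\<close>
      using key[of "1 / (nrm a)\<^sup>2"] by (simp add: power_divide field_simps)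
  qed
  then have "(cmod t)\<^sup>2 \<le> (nrm a * nrm b)\<^sup>2"
    by (simp add: T_def power_mult_distrib)
  then show ?thesis
    unfolding t_def by (rule power2_le_imp_le) simp
qed

lemma nrm_triangle: "nrm (a + b) \<le> nrm a + nrm b"
proof (rule power2_le_imp_le)
  have "Re (\<tau> (star a * b)) \<le> nrm a * nrm b"
    using Cauchy_Schwarz[of a b] complex_Re_le_cmod order_trans by blast
  then show "(nrm (a + b))\<^sup>2 \<le> (nrm a + nrm b)\<^sup>2"
    by (simp add: nrm_add_power2 power2_sum)
qed simp

lemma nrm_triangle_diff: "nrm (a - b) \<le> nrm a + nrm b"
  using nrm_triangle[of a "- b"] by simp

lemma nrm_sum: "nrm (sum x I) \<le> (\<Sum>i\<in>I. nrm (x i))"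
proof (induction I rule: infinite_finite_induct)
  case (insert i I)
  then show ?case
    using nrm_triangle[of "x i" "sum x I"] by simp
qed simp_all

lemma cmod_tau_le: "cmod (\<tau> a) \<le> nrm a"
  using Cauchy_Schwarz[of 1 a] by simp

text \<open>Two-sided multiplication bound, playing the role of an operator norm of at most \<open>1\<close>. Both sides are needed,
  as a product is estimated in the seminorm through either of its factors.\<close>

definition contractive :: "'r \<Rightarrow> bool" where
  "contractive x \<longleftrightarrow> (\<forall>b. nrm (x * b) \<le> nrm b \<and> nrm (b * x) \<le> nrm b)"

lemma contractive_left: "contractive x \<Longrightarrow> nrm (x * b) \<le> nrm b"
  and contractive_right: "contractive x \<Longrightarrow> nrm (b * x) \<le> nrm b"
  by (simp_all add: contractive_def)

lemma contractive_one: "contractive 1"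
  by (simp add: contractive_def)

lemma contractive_mult: "contractive x \<Longrightarrow> contractive y \<Longrightarrow> contractive (x * y)"
  unfolding contractive_def by (metis mult.assoc order_trans)

lemma contractive_power: "contractive x \<Longrightarrow> contractive (x ^ n)"
  by (induction n) (simp_all add: contractive_one contractive_mult)

lemma contractive_star:
  assumes "contractive x"
  shows "contractive (star x)"
proof -
  have "nrm (star x * b) = nrm (star b * x)" "nrm (b * star x) = nrm (x * star b)" for b
    using nrm_star[of "star x * b"] nrm_star[of "b * star x"] by (simp_all add: star_mult)
  then show ?thesis
    using assms unfolding contractive_def by (metis nrm_star)
qed

lemma contractive_scal_sum:
  assumes "\<And>i. i \<in> I \<Longrightarrow> contractive (x i)" and "t \<ge> 0" and "t * of_nat (card I) \<le> 1"
  shows "contractive (scal (of_real t) * sum x I)"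
proof -
  have le: "t * (\<Sum>i\<in>I. nrm (y i)) \<le> nrm b" if "\<And>i. i \<in> I \<Longrightarrow> nrm (y i) \<le> nrm b" for y b
  proof -
    have "(\<Sum>i\<in>I. nrm (y i)) \<le> of_nat (card I) * nrm b"
      using that by (rule sum_bounded_above)
    then have "t * (\<Sum>i\<in>I. nrm (y i)) \<le> (t * of_nat (card I)) * nrm b"
      using \<open>t \<ge> 0\<close> by (simp add: mult.assoc mult_left_mono)
    also have "\<dots> \<le> 1 * nrm b"
      using assms(3) by (intro mult_right_mono) simp_all
    finally show ?thesis by simp
  qed
  have "nrm (scal (of_real t) * sum x I * b) \<le> nrm b" for b
  proof -
    have "nrm (scal (of_real t) * sum x I * b) = t * nrm (\<Sum>i\<in>I. x i * b)"
      using \<open>t \<ge> 0\<close> by (simp add: mult.assoc nrm_scal sum_distrib_right)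
    also have "\<dots> \<le> t * (\<Sum>i\<in>I. nrm (x i * b))"
      using \<open>t \<ge> 0\<close> by (intro mult_left_mono nrm_sum)
    also have "\<dots> \<le> nrm b"
      using assms(1) by (intro le) (simp add: contractive_left)
    finally show ?thesis .
  qed
  moreover have "nrm (b * (scal (of_real t) * sum x I)) \<le> nrm b" for b
  proof -
    have "b * (scal (of_real t) * sum x I) = scal (of_real t) * (\<Sum>i\<in>I. b * x i)"
      by (metis mult.assoc scal_commute sum_distrib_left)
    then have "nrm (b * (scal (of_real t) * sum x I)) = t * nrm (\<Sum>i\<in>I. b * x i)"
      using \<open>t \<ge> 0\<close> by (simp add: nrm_scal)
    also have "\<dots> \<le> t * (\<Sum>i\<in>I. nrm (b * x i))"
      using \<open>t \<ge> 0\<close> by (intro mult_left_mono nrm_sum)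
    also have "\<dots> \<le> nrm b"
      using assms(1) by (intro le) (simp add: contractive_right)
    finally show ?thesis .
  qed
  ultimately show ?thesis
    by (simp add: contractive_def)
qed

text \<open>By polarization: \<open>4 nrm(w b)\<^sup>2\<close> is the difference of the values of the quadratic form of \<open>w\<close> at
  \<open>b + w b\<close> and at \<open>b - w b\<close>, hence at most \<open>2 nrm(b)\<^sup>2 + 2 nrm(w b)\<^sup>2\<close>.\<close>

lemma selfadjoint_contractive:
  assumes w: "star w = w" and bd: "\<And>b. \<bar>Re (\<tau> (star b * w * b))\<bar> \<le> (nrm b)\<^sup>2"
  shows "contractive w"
proof -
  have left: "nrm (w * b) \<le> nrm b" for b
  proof (rule power2_le_imp_le)
    let ?c = "w * b"
    have exp: "star (b + ?c) * w * (b + ?c) - star (b - ?c) * w * (b - ?c)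
        = (star b * w * ?c + star b * w * ?c) + (star ?c * w * b + star ?c * w * b)"
      by (simp add: star_add star_diff algebra_simps)
    have e2: "star b * w * ?c = star ?c * ?c" "star ?c * w * b = star ?c * ?c"
      by (simp_all add: star_mult w mult.assoc)
    have "4 * (nrm ?c)\<^sup>2 = Re (\<tau> (star (b + ?c) * w * (b + ?c) - star (b - ?c) * w * (b - ?c)))"
      unfolding exp e2 by (simp add: nrm_power2 tau_add)
    also have "\<dots> \<le> (nrm (b + ?c))\<^sup>2 + (nrm (b - ?c))\<^sup>2"
      using bd[of "b + ?c"] bd[of "b - ?c"] unfolding tau_diff minus_complex.sel by linarith
    also have "\<dots> = 2 * (nrm b)\<^sup>2 + 2 * (nrm ?c)\<^sup>2"
      by (rule parallelogram)
    finally show "(nrm ?c)\<^sup>2 \<le> (nrm b)\<^sup>2" by simp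
  qed simp
  moreover have "nrm (b * w) \<le> nrm b" for b
    using left[of "star b"] nrm_star[of "b * w"] by (simp add: star_mult w)
  ultimately show ?thesis
    by (simp add: contractive_def)
qed

text \<open>Unitary modulo the kernel of \<open>\<tau>\<close>. In the algebra of words below, a word times its formal
  inverse is not \<open>1\<close>, but \<open>\<tau>\<close> does not see the difference.\<close>

definition unitary :: "'r \<Rightarrow> bool" where
  "unitary u \<longleftrightarrow> (\<forall>b. \<tau> (star u * u * b) = \<tau> b) \<and> (\<forall>b. \<tau> (u * star u * b) = \<tau> b)"

lemma unitary_contractive:
  assumes "unitary u"
  shows "contractive u"
proof -
  have "nrm (u * b) = nrm b" for b
  proof -
    have "\<tau> (star (u * b) * (u * b)) = \<tau> ((star b * star u * u) * b)"
      by (simp add: star_mult mult.assoc)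
    also have "\<dots> = \<tau> (b * (star b * star u * u))"
      by (rule tau_commute)
    also have "\<dots> = \<tau> ((b * star b) * (star u * u))"
      by (simp add: mult.assoc)
    also have "\<dots> = \<tau> (star u * u * (b * star b))"
      by (rule tau_commute)
    also have "\<dots> = \<tau> (star b * b)"
      using assms by (simp add: unitary_def tau_commute)
    finally show ?thesis by (simp add: nrm_def)
  qed
  moreover have "nrm (b * u) = nrm b" for b
  proof -
    have "\<tau> (star (b * u) * (b * u)) = \<tau> (star u * (star b * b * u))"
      by (simp add: star_mult mult.assoc)
    also have "\<dots> = \<tau> (star b * b * u * star u)"
      by (rule tau_commute)
    also have "\<dots> = \<tau> ((star b * b) * (u * star u))"
      by (simp add: mult.assoc)
    also have "\<dots> = \<tau> (u * star u * (star b * b))"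
      by (rule tau_commute)
    also have "\<dots> = \<tau> (star b * b)"
      using assms by (simp add: unitary_def)
    finally show ?thesis by (simp add: nrm_def)
  qed
  ultimately show ?thesis
    by (simp add: contractive_def)
qed

text \<open>Midpoints suffice in place of all convex combinations: the minimization below only uses the
  parallelogram law.\<close>

inductive_set averages :: "'r set \<Rightarrow> 'r set" for S where
  base: "s \<in> S \<Longrightarrow> s \<in> averages S"
| midpoint: "a \<in> averages S \<Longrightarrow> b \<in> averages S \<Longrightarrow> scal (1/2) * (a + b) \<in> averages S"

lemma averages_star:
  assumes "\<And>s. s \<in> S \<Longrightarrow> star s \<in> S" and "a \<in> averages S"
  shows "star a \<in> averages S"
  using assms(2)
proof induction
  case (base s)
  then show ?case using assms(1) by (blast intro: averages.base)
next
  case (midpoint a b)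
  have "star (scal (1/2) * (a + b)) = scal (1/2) * (star a + star b)"
    by (metis complex_cnj_divide complex_cnj_numeral complex_cnj_one scal_commute star_add
        star_mult star_scal)
  then show ?case
    using midpoint averages.midpoint by simp
qed

lemma averages_mult:
  assumes "\<And>s t. s \<in> S \<Longrightarrow> t \<in> S \<Longrightarrow> s * t \<in> S" and a: "a \<in> averages S" and b: "b \<in> averages S"
  shows "a * b \<in> averages S"
  using a
proof induction
  case (base s)
  show ?case
    using b
  proof induction
    case (base t)
    then show ?case using \<open>s \<in> S\<close> assms(1) by (blast intro: averages.base)
  next
    case (midpoint a b)
    have "s * (scal (1/2) * (a + b)) = scal (1/2) * (s * a + s * b)"
      by (metis distrib_left mult.assoc scal_commute)
    then show ?case
      using midpoint averages.midpoint by simp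
  qed
next
  case (midpoint a a')
  have "scal (1/2) * (a + a') * b = scal (1/2) * (a * b + a' * b)"
    by (metis distrib_right mult.assoc)
  then show ?case
    using midpoint averages.midpoint by simp
qed

lemma nrm_midpoint_le:
  assumes "nrm x \<le> r" and "nrm y \<le> r"
  shows "nrm (scal (1/2) * (x + y)) \<le> r"
  using assms nrm_triangle[of x y] by (simp add: nrm_scal)

lemma averages_contractive:
  assumes "\<And>s. s \<in> S \<Longrightarrow> unitary s" and "a \<in> averages S"
  shows "contractive a"
  using assms(2)
proof induction
  case (base s)
  then show ?case using assms(1) unitary_contractive by blast
next
  case (midpoint a b)
  have "nrm (scal (1/2) * (a + b) * x) \<le> nrm x" for x
  proof -
    have "scal (1/2) * (a + b) * x = scal (1/2) * (a * x + b * x)"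
      by (metis distrib_right mult.assoc)
    then show ?thesis
      using nrm_midpoint_le[of "a * x" "nrm x" "b * x"] midpoint.IH by (simp add: contractive_left)
  qed
  moreover have "nrm (x * (scal (1/2) * (a + b))) \<le> nrm x" for x
  proof -
    have "x * (scal (1/2) * (a + b)) = scal (1/2) * (x * a + x * b)"
      by (metis distrib_left mult.assoc scal_commute)
    then show ?thesis
      using nrm_midpoint_le[of "x * a" "nrm x" "x * b"] midpoint.IH by (simp add: contractive_right)
  qed
  ultimately show ?case
    by (simp add: contractive_def)
qed

definition unitary_monoid :: "'r set \<Rightarrow> bool" where
  "unitary_monoid S \<longleftrightarrow> S \<noteq> {} \<and> (\<forall>s\<in>S. unitary s \<and> star s \<in> S) \<and> (\<forall>s\<in>S. \<forall>t\<in>S. s * t \<in> S)"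

text \<open>The element \<open>a* a\<close> approximates the projection onto the \<open>S\<close>-invariant vectors. That projection is the
  element of least norm in the closed convex hull of \<open>S\<close>, and by the parallelogram law any two averages of nearly
  least norm are close to each other. All of \<open>a* a\<close>, \<open>u a* a\<close> and \<open>(a* a)\<^sup>2\<close> are such averages when \<open>a\<close> is one.
  Passing from \<open>a\<close> to \<open>a* a\<close> makes the element positive.\<close>

lemma almost_invariant_average:
  assumes S: "unitary_monoid S"
    and lower: "\<And>a. a \<in> averages S \<Longrightarrow> l \<le> (nrm a)\<^sup>2" and "e > 0"
  obtains a where "contractive a"
    and "\<forall>u\<in>S. nrm (u * (star a * a) - star a * a) \<le> e"
    and "nrm ((star a * a) * (star a * a) - star a * a) \<le> e"
    and "l \<le> Re (\<tau> (star a * a))"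
proof -
  have ne: "S \<noteq> {}" and unit: "\<And>s. s \<in> S \<Longrightarrow> unitary s"
    and mult: "\<And>s t. s \<in> S \<Longrightarrow> t \<in> S \<Longrightarrow> s * t \<in> S"
    and star: "\<And>s. s \<in> S \<Longrightarrow> star s \<in> S"
    using S by (auto simp: unitary_monoid_def)
  let ?A = "averages S"
  define m where "m = Inf ((\<lambda>a. (nrm a)\<^sup>2) ` ?A)"
  have neA: "?A \<noteq> {}" using ne averages.base by blast
  have bdd: "bdd_below ((\<lambda>a. (nrm a)\<^sup>2) ` ?A)"
    by (rule bdd_belowI2[of _ 0]) simp
  have m_le: "m \<le> (nrm a)\<^sup>2" if "a \<in> ?A" for a
    unfolding m_def using that bdd by (rule cINF_lower[rotated])
  have "\<exists>a\<in>?A. (nrm a)\<^sup>2 < m + (e/2)\<^sup>2"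
    using cInf_lessD[of "(\<lambda>a. (nrm a)\<^sup>2) ` ?A" "m + (e/2)\<^sup>2"] neA \<open>e > 0\<close> m_def by auto
  then obtain a where a: "a \<in> ?A" "(nrm a)\<^sup>2 < m + (e/2)\<^sup>2" by blast
  have close: "nrm (x - y) \<le> e"
    if "x \<in> ?A" "nrm x \<le> nrm a" "y \<in> ?A" "nrm y \<le> nrm a" for x y
  proof (rule power2_le_imp_le)
    have "m \<le> (nrm (scal (1/2) * (x + y)))\<^sup>2"
      using that by (intro m_le averages.midpoint)
    then have "4 * m \<le> (nrm (x + y))\<^sup>2"
      by (simp add: nrm_scal power2_eq_square)
    moreover have "(nrm x)\<^sup>2 \<le> (nrm a)\<^sup>2" "(nrm y)\<^sup>2 \<le> (nrm a)\<^sup>2"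
      using that by (simp_all add: power_mono)
    moreover have "(nrm a)\<^sup>2 < m + e\<^sup>2 / 4"
      using a(2) by (simp add: power_divide)
    ultimately show "(nrm (x - y))\<^sup>2 \<le> e\<^sup>2"
      using parallelogram[of x y] by linarith
  qed (use \<open>e > 0\<close> in simp)
  let ?p = "star a * a"
  have ctr: "contractive a" "contractive (star a)"
    using a(1) unit averages_contractive contractive_star by blast+
  have p: "?p \<in> ?A" "nrm ?p \<le> nrm a"
    using a(1) averages_mult[OF mult] averages_star[OF star] ctr contractive_left by simp_all
  have ctrp: "contractive ?p" using ctr contractive_mult by blast
  show ?thesis
  proof
    show "contractive a" by (rule ctr)
    show "\<forall>u\<in>S. nrm (u * ?p - ?p) \<le> e"
    proof (intro ballI close)
      fix u assume that: "u \<in> S"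
      show "u * ?p \<in> ?A" using that p averages.base averages_mult[OF mult] by blast
      show "nrm (u * ?p) \<le> nrm a"
        using contractive_left[OF unitary_contractive[OF unit[OF that]], of ?p] p by linarith
    qed (use p in simp_all)
    show "nrm (?p * ?p - ?p) \<le> e"
    proof (rule close)
      show "?p * ?p \<in> ?A" using p averages_mult[OF mult] by blast
      show "nrm (?p * ?p) \<le> nrm a"
        using contractive_left[OF ctrp, of ?p] p by linarith
    qed (use p in simp_all)
    show "l \<le> Re (\<tau> ?p)"
      using lower[OF a(1)] by (simp add: nrm_power2)
  qed
qed


text \<open>The central estimate. With \<open>w = p + q - 1\<close> and \<open>v = p - q\<close>, the relations \<open>w\<^sup>2 + v\<^sup>2 = 1\<close> and
  \<open>w v = - v w\<close> hold up to multiples of \<open>p\<^sup>2 - p\<close> and \<open>q\<^sup>2 - q\<close>, so the odd powers of \<open>w\<close> have trace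
  close to \<open>\<tau>(w)\<close>, while the even powers have non-negative trace. The element \<open>f\<close> is the mean of the
  first \<open>2 M\<close> powers of \<open>w\<close>. Its trace is therefore about \<open>\<tau>(w) / 2\<close> or more, and it is almost
  fixed by \<open>w\<close> since \<open>f - w f\<close> telescopes. As \<open>1 - w = (1 - p) + (1 - q)\<close> is a sum of positive elements, \<open>f\<close> is almost
  fixed by \<open>p\<close> and \<open>q\<close> separately.\<close>

lemma cesaro_mean_near_fixed_points:
  fixes a b :: 'r and M :: nat and e :: real
  defines "p \<equiv> star a * a" and "q \<equiv> star b * b"
  assumes a: "contractive a" and b: "contractive b"
    and p_e: "nrm (p * p - p) \<le> e" and q_e: "nrm (q * q - q) \<le> e" and "M > 0"
  obtains f where "contractive f"
    and "(nrm (f - p * f))\<^sup>2 \<le> 1 / M" and "(nrm (f - q * f))\<^sup>2 \<le> 1 / M"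
    and "(Re (\<tau> p) + Re (\<tau> q) - 1 - 4 * ((real M)\<^sup>2 * e)) / 2 \<le> Re (\<tau> f)"
proof -
  define w where "w = p + q - 1"
  define v where "v = p - q"
  have "e \<ge> 0" using p_e nrm_nonneg order_trans by blast
  have star: "star p = p" "star q = q" "star w = w" "star v = v"
    by (simp_all add: p_def q_def w_def v_def star_mult star_add star_diff)
  have cp: "contractive p" and cq: "contractive q"
    using a b by (simp_all add: p_def q_def contractive_mult contractive_star)
  have quad: "\<tau> (star x * p * x) = of_real ((nrm (a * x))\<^sup>2)"
    "\<tau> (star x * q * x) = of_real ((nrm (b * x))\<^sup>2)" for x
    using tau_star_mult_self[of "a * x"] tau_star_mult_self[of "b * x"]
    by (simp_all add: p_def q_def star_mult mult.assoc)
  have quad_le: "(nrm (a * x))\<^sup>2 \<le> (nrm x)\<^sup>2" "(nrm (b * x))\<^sup>2 \<le> (nrm x)\<^sup>2" for x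
    using a b by (simp_all add: contractive_left power_mono)
  \<comment> \<open>The quadratic form of \<open>w\<close> takes values between \<open>-1\<close> and \<open>1\<close>, so \<open>w\<close> is contractive.\<close>
  have quad_w: "Re (\<tau> (star x * w * x)) = (nrm (a * x))\<^sup>2 + (nrm (b * x))\<^sup>2 - (nrm x)\<^sup>2" for x
  proof -
    have "star x * w * x = star x * p * x + star x * q * x - star x * x"
      by (simp add: w_def algebra_simps)
    then show ?thesis
      by (simp add: tau_diff tau_add quad flip: nrm_power2)
  qed
  have cw: "contractive w"
  proof (rule selfadjoint_contractive)
    show "\<bar>Re (\<tau> (star x * w * x))\<bar> \<le> (nrm x)\<^sup>2" for x
      using quad_le[of x] zero_le_power2[of "nrm (a * x)"] zero_le_power2[of "nrm (b * x)"]
      unfolding quad_w by linarith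
  qed (rule star)
  have v_right: "nrm (x * v) \<le> 2 * nrm x" for x
    using nrm_triangle_diff[of "x * p" "x * q"] contractive_right[OF cp, of x]
      contractive_right[OF cq, of x] by (simp add: v_def right_diff_distrib)
  \<comment> \<open>By how much \<open>p\<close> and \<open>q\<close> fail to be projections, which is the error in both relations.\<close>
  define d where "d = p * p - p"
  define d' where "d' = q * q - q"
  have sum_sq: "w * w + v * v - 1 = (d + d) + (d' + d')"
    by (simp add: w_def v_def d_def d'_def algebra_simps)
  have anti: "w * v + v * w = (d + d) - (d' + d')"
    by (simp add: w_def v_def d_def d'_def algebra_simps)
  have d: "nrm (d + d) \<le> 2 * e" "nrm (d' + d') \<le> 2 * e"
    using nrm_triangle[of d d] nrm_triangle[of d' d'] p_e q_e by (simp_all add: d_def d'_def)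
  have r1: "nrm (w * w + v * v - 1) \<le> 4 * e"
    unfolding sum_sq using nrm_triangle[of "d + d" "d' + d'"] d by simp
  have r2: "nrm (w * v + v * w) \<le> 4 * e"
    unfolding anti using nrm_triangle_diff[of "d + d" "d' + d'"] d by simp
  \<comment> \<open>Moving \<open>v\<close> past each of the \<open>m\<close> factors costs one error of size \<open>4 e\<close>.\<close>
  have comm: "nrm (w ^ m * v - (-1) ^ m * (v * w ^ m)) \<le> 4 * real m * e" for m
  proof (induction m)
    case 0
    then show ?case by simp
  next
    case (Suc m)
    let ?E = "w ^ m * v - (-1) ^ m * (v * w ^ m)"
    let ?s = "(-1) ^ m :: 'r"
    have s: "?s * x = x * ?s" for x
      by (cases "even m") simp_all
    have E: "w ^ Suc m * v - (-1) ^ Suc m * (v * w ^ Suc m)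
        = w * ?E + ?s * ((w * v + v * w) * w ^ m)"
      using s[of w] by (simp add: algebra_simps) (simp flip: mult.assoc)
    have nrm_s: "nrm (?s * x) = nrm x" for x
      by (cases "even m") simp_all
    have "nrm (w * ?E) \<le> 4 * real m * e"
      by (rule order_trans[OF contractive_left[OF cw] Suc.IH])
    moreover have "nrm ((w * v + v * w) * w ^ m) \<le> 4 * e"
      by (rule order_trans[OF contractive_right[OF contractive_power[OF cw]] r2])
    moreover have "4 * real (Suc m) * e = 4 * real m * e + 4 * e"
      by (simp add: algebra_simps)
    ultimately show ?case
      unfolding E using nrm_triangle[of "w * ?E" "?s * ((w * v + v * w) * w ^ m)"]
        nrm_s[of "(w * v + v * w) * w ^ m"] by linarith
  qed
  \<comment> \<open>The trace property gives \<open>\<tau>(w\<^sup>m v v) = \<tau>(v w\<^sup>m v)\<close>, anticommutation the opposite sign.\<close>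
  have vv: "cmod (\<tau> (w ^ m * (v * v))) \<le> 4 * real m * e" if "odd m" for m
  proof -
    have "\<tau> (v * w ^ m * v) = \<tau> (w ^ m * (v * v))"
      using tau_commute[of v "w ^ m * v"] by (simp add: mult.assoc)
    then have "2 * \<tau> (w ^ m * (v * v)) = \<tau> ((w ^ m * v - (-1) ^ m * (v * w ^ m)) * v)"
      using that by (simp add: tau_add distrib_right mult.assoc)
    then have "2 * cmod (\<tau> (w ^ m * (v * v))) = cmod (\<tau> ((w ^ m * v - (-1) ^ m * (v * w ^ m)) * v))"
      by (metis norm_mult norm_numeral)
    also have "\<dots> \<le> nrm ((w ^ m * v - (-1) ^ m * (v * w ^ m)) * v)"
      by (rule cmod_tau_le)
    also have "\<dots> \<le> 2 * (4 * real m * e)"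
      using v_right[of "w ^ m * v - (-1) ^ m * (v * w ^ m)"] comm[of m] by linarith
    finally show ?thesis by linarith
  qed
  have step: "Re (\<tau> (w ^ m)) - 4 * (real m + 1) * e \<le> Re (\<tau> (w ^ (m + 2)))" if "odd m" for m
  proof -
    have "w ^ (m + 2) - w ^ m = w ^ m * (w * w + v * v - 1) - w ^ m * (v * v)"
      by (simp only: right_diff_distrib distrib_left power_add power2_eq_square mult_1_right)
        (simp add: algebra_simps)
    then have "Re (\<tau> (w ^ (m + 2))) - Re (\<tau> (w ^ m))
        = Re (\<tau> (w ^ m * (w * w + v * v - 1))) - Re (\<tau> (w ^ m * (v * v)))"
      by (metis minus_complex.sel(1) tau_diff)
    moreover have "cmod (\<tau> (w ^ m * (w * w + v * v - 1))) \<le> 4 * e"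
      using cmod_tau_le contractive_left[OF contractive_power[OF cw]] r1 order_trans by meson
    ultimately show ?thesis
      using vv[OF that] abs_Re_le_cmod[of "\<tau> (w ^ m * (w * w + v * v - 1))"]
        abs_Re_le_cmod[of "\<tau> (w ^ m * (v * v))"] by (simp add: algebra_simps)
  qed
  have odd_power: "Re (\<tau> w) - 4 * (real k * (real k + 1) * e) \<le> Re (\<tau> (w ^ (2 * k + 1)))" for k
  proof (induction k)
    case 0
    then show ?case by simp
  next
    case (Suc k)
    then show ?case
      using step[of "2 * k + 1"] by (simp add: algebra_simps)
  qed
  define \<delta> where "\<delta> = Re (\<tau> p) + Re (\<tau> q) - 1 - 4 * ((real M)\<^sup>2 * e)"
  have odd: "\<delta> \<le> Re (\<tau> (w ^ (2 * k + 1)))" if "k < M" for k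
  proof -
    have "k * (k + 1) \<le> M * M"
      using that by (intro mult_mono) simp_all
    then have "real k * (real k + 1) \<le> (real M)\<^sup>2"
      by (metis of_nat_1 of_nat_add of_nat_le_iff of_nat_mult power2_eq_square)
    then have "real k * (real k + 1) * e \<le> (real M)\<^sup>2 * e"
      using \<open>e \<ge> 0\<close> by (rule mult_right_mono)
    then show ?thesis
      using odd_power[of k] by (simp add: \<delta>_def w_def tau_diff tau_add algebra_simps)
  qed
  have even: "0 \<le> Re (\<tau> (w ^ (2 * k + 2)))" for k
  proof -
    have "w ^ (2 * k + 2) = w ^ (k + 1 + (k + 1))"
      by (rule arg_cong) simp
    then have "star (w ^ (k + 1)) * w ^ (k + 1) = w ^ (2 * k + 2)"
      unfolding star_power star power_add[symmetric] by (rule sym)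
    then show ?thesis using tau_nonneg[of "w ^ (k + 1)"] by simp
  qed
  define g where "g = (\<Sum>k<2 * M. w ^ (k + 1))"
  define f where "f = scal (of_real (1 / (2 * M))) * g"
  have cf: "contractive f"
    unfolding f_def g_def using \<open>M > 0\<close>
    by (intro contractive_scal_sum contractive_power cw) simp_all
  have "M * \<delta> \<le> Re (\<tau> g)"
  proof -
    have "(\<Sum>k<2 * n. Re (\<tau> (w ^ (k + 1)))) =
        (\<Sum>k<n. Re (\<tau> (w ^ (2 * k + 1))) + Re (\<tau> (w ^ (2 * k + 2))))" for n
      by (induction n) simp_all
    then have "Re (\<tau> g) = (\<Sum>k<M. Re (\<tau> (w ^ (2 * k + 1))) + Re (\<tau> (w ^ (2 * k + 2))))"
      by (simp add: g_def tau_sum)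
    also have "\<dots> \<ge> (\<Sum>k<M. \<delta>)"
    proof (rule sum_mono)
      fix k assume "k \<in> {..<M}"
      then show "\<delta> \<le> Re (\<tau> (w ^ (2 * k + 1))) + Re (\<tau> (w ^ (2 * k + 2)))"
        using odd[of k] even[of k] by simp
    qed
    finally show ?thesis by simp
  qed
  then have tau_f: "\<delta> / 2 \<le> Re (\<tau> f)"
    using \<open>M > 0\<close> by (simp add: f_def tau_scal field_simps)
  have fixed: "nrm (f - w * f) \<le> 1 / M"
  proof -
    have "(\<Sum>k<n. w ^ (k + 1)) - w * (\<Sum>k<n. w ^ (k + 1)) = w - w ^ (n + 1)" for n
    proof (induction n)
      case 0
      then show ?case by simp
    next
      case (Suc n)
      have "(\<Sum>k<Suc n. w ^ (k + 1)) - w * (\<Sum>k<Suc n. w ^ (k + 1))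
          = ((\<Sum>k<n. w ^ (k + 1)) - w * (\<Sum>k<n. w ^ (k + 1))) + (w ^ (n + 1) - w ^ (Suc n + 1))"
        by (simp add: distrib_left del: sum.lessThan_Suc_shift)
      then show ?case
        unfolding Suc.IH by simp
    qed
    then have G: "g - w * g = w - w ^ (2 * M + 1)"
      by (simp add: g_def)
    have F: "f - w * f = scal (of_real (1 / (2 * M))) * (g - w * g)"
    proof -
      have "w * f = scal (of_real (1 / (2 * M))) * (w * g)"
        unfolding f_def by (simp only: mult.assoc[symmetric] scal_commute[of _ w, symmetric])
      then show ?thesis
        unfolding right_diff_distrib by (simp only: f_def)
    qed
    have le2: "nrm (w - w ^ (2 * M + 1)) \<le> 2"
      using nrm_triangle_diff[of w "w ^ (2 * M + 1)"] contractive_left[OF cw, of 1]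
        contractive_left[OF contractive_power[OF cw, of "2 * M + 1"], of 1]
      by (simp del: power_Suc)
    have "nrm (f - w * f) = 1 / (2 * M) * nrm (w - w ^ (2 * M + 1))"
      unfolding F G nrm_scal norm_of_real by simp
    also have "\<dots> \<le> 1 / (2 * M) * 2"
      using le2 by (rule mult_left_mono) simp
    finally show ?thesis by simp
  qed
  have nrm_f: "nrm f \<le> 1"
    using contractive_left[OF cf, of 1] by simp
  have "(nrm f)\<^sup>2 - Re (\<tau> (star f * w * f)) \<le> 1 / M"
  proof -
    have "(nrm f)\<^sup>2 - Re (\<tau> (star f * w * f)) = Re (\<tau> (star f * (f - w * f)))"
      by (simp add: nrm_power2 right_diff_distrib tau_diff mult.assoc)
    also have "\<dots> \<le> nrm f * nrm (f - w * f)"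
      using Cauchy_Schwarz complex_Re_le_cmod order_trans by blast
    also have "\<dots> \<le> 1 * (1 / M)"
      using nrm_f fixed by (intro mult_mono) simp_all
    finally show ?thesis by simp
  qed
  then have defect: "((nrm f)\<^sup>2 - (nrm (a * f))\<^sup>2) + ((nrm f)\<^sup>2 - (nrm (b * f))\<^sup>2) \<le> 1 / M"
    unfolding quad_w by simp
  \<comment> \<open>For a contractive \<open>x\<close> one has \<open>(1 - x* x)\<^sup>2 \<le> 1 - x* x\<close> as quadratic forms.\<close>
  have "(nrm (f - star x * x * f))\<^sup>2 \<le> (nrm f)\<^sup>2 - (nrm (x * f))\<^sup>2" if "contractive x" for x
  proof -
    have "nrm (star x * (x * f)) \<le> nrm (x * f)"
      using that by (simp add: contractive_left contractive_star)
    then have "(nrm (star x * x * f))\<^sup>2 \<le> (nrm (x * f))\<^sup>2"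
      by (simp add: mult.assoc power_mono)
    moreover have "Re (\<tau> (star f * (star x * x * f))) = (nrm (x * f))\<^sup>2"
      by (simp add: nrm_power2 star_mult mult.assoc)
    ultimately show ?thesis
      by (simp add: nrm_diff_power2)
  qed
  from this[OF a] this[OF b] have "(nrm (f - p * f))\<^sup>2 \<le> 1 / M" "(nrm (f - q * f))\<^sup>2 \<le> 1 / M"
    using defect quad_le[of f] unfolding p_def q_def by linarith+
  then show ?thesis
    using that[OF cf] tau_f unfolding \<delta>_def by blast
qed


text \<open>The length \<open>2 M\<close> of the mean is chosen first, the quality \<open>e\<close> of the approximate projections
  afterwards, because the error of the trace estimate grows with \<open>M\<close>.\<close>

lemma almost_fixed_by_both:
  assumes S: "unitary_monoid S1" "unitary_monoid S2"
    and l1: "\<And>a. a \<in> averages S1 \<Longrightarrow> l1 \<le> (nrm a)\<^sup>2"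
    and l2: "\<And>a. a \<in> averages S2 \<Longrightarrow> l2 \<le> (nrm a)\<^sup>2" and "\<eta> > 0"
  obtains f where "contractive f" and "\<forall>u\<in>S1 \<union> S2. nrm (u * f - f) \<le> \<eta>"
    and "(l1 + l2 - 1) / 2 - \<eta> \<le> Re (\<tau> f)"
proof -
  define M where "M = nat \<lceil>(4 / \<eta>)\<^sup>2\<rceil> + 1"
  have "M > 0" by (simp add: M_def)
  have "(4 / \<eta>)\<^sup>2 \<le> M"
    unfolding M_def by linarith
  then have M: "1 / M \<le> (\<eta> / 4)\<^sup>2"
    using \<open>M > 0\<close> \<open>\<eta> > 0\<close> by (simp add: power_divide field_simps)
  define e where "e = min (\<eta> / 2) (\<eta> / (2 * (real M)\<^sup>2))"
  have e: "e > 0" "e \<le> \<eta> / 2" "2 * ((real M)\<^sup>2 * e) \<le> \<eta>"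
  proof -
    have "e \<le> \<eta> / (2 * (real M)\<^sup>2)" by (simp add: e_def)
    then show "2 * ((real M)\<^sup>2 * e) \<le> \<eta>"
      using \<open>M > 0\<close> by (simp add: field_simps)
  qed (use \<open>M > 0\<close> \<open>\<eta> > 0\<close> in \<open>simp_all add: e_def\<close>)
  obtain a where a: "contractive a"
      "\<forall>u\<in>S1. nrm (u * (star a * a) - star a * a) \<le> e"
      "nrm ((star a * a) * (star a * a) - star a * a) \<le> e" "l1 \<le> Re (\<tau> (star a * a))"
    by (rule almost_invariant_average[OF S(1) l1 e(1)])
  obtain b where b: "contractive b"
      "\<forall>u\<in>S2. nrm (u * (star b * b) - star b * b) \<le> e"
      "nrm ((star b * b) * (star b * b) - star b * b) \<le> e" "l2 \<le> Re (\<tau> (star b * b))"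
    by (rule almost_invariant_average[OF S(2) l2 e(1)])
  obtain f where f: "contractive f"
      "(nrm (f - star a * a * f))\<^sup>2 \<le> 1 / M" "(nrm (f - star b * b * f))\<^sup>2 \<le> 1 / M"
      "(Re (\<tau> (star a * a)) + Re (\<tau> (star b * b)) - 1 - 4 * ((real M)\<^sup>2 * e)) / 2 \<le> Re (\<tau> f)"
    by (rule cesaro_mean_near_fixed_points[OF a(1) b(1) a(3) b(3) \<open>M > 0\<close>])
  have near: "nrm (u * f - f) \<le> \<eta>"
    if "contractive u" "nrm (u * p - p) \<le> e" "(nrm (f - p * f))\<^sup>2 \<le> 1 / M" for u p
  proof -
    have r: "nrm (f - p * f) \<le> \<eta> / 4"
      using \<open>\<eta> > 0\<close> by (intro power2_le_imp_le[OF order_trans[OF that(3) M]]) simp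
    have split: "u * f - f = u * (f - p * f) + ((u * p - p) * f - (f - p * f))"
      by (simp add: algebra_simps)
    have "nrm (u * f - f) \<le> nrm (u * (f - p * f)) + (nrm ((u * p - p) * f) + nrm (f - p * f))"
      unfolding split using nrm_triangle[of "u * (f - p * f)" "(u * p - p) * f - (f - p * f)"]
        nrm_triangle_diff[of "(u * p - p) * f" "f - p * f"] by linarith
    moreover have "nrm (u * (f - p * f)) \<le> nrm (f - p * f)"
      using that(1) by (rule contractive_left)
    moreover have "nrm ((u * p - p) * f) \<le> nrm (u * p - p)"
      using f(1) by (rule contractive_right)
    ultimately show ?thesis
      using r that(2) e(2) by linarith
  qed
  show ?thesis
  proof (rule that[OF f(1)])
    show "\<forall>u\<in>S1 \<union> S2. nrm (u * f - f) \<le> \<eta>"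
    proof
      fix u assume that: "u \<in> S1 \<union> S2"
      have "contractive u"
        using that S unitary_contractive by (auto simp: unitary_monoid_def)
      then show "nrm (u * f - f) \<le> \<eta>"
        using that near[of u] a(2) b(2) f(2,3) by blast
    qed
    show "(l1 + l2 - 1) / 2 - \<eta> \<le> Re (\<tau> f)"
    proof -
      have arith: "(l1 + l2 - 1) / 2 - \<eta> \<le> F"
        if "(P + Q - 1 - 4 * X) / 2 \<le> F" "l1 \<le> P" "l2 \<le> Q" "2 * X \<le> \<eta>" for P Q X F :: real
        using that by (simp add: field_simps)
      show ?thesis
        by (rule arith[OF f(4) a(4) b(4) e(3)])
    qed
  qed
qed

text \<open>On \<open>f\<close> the element \<open>a = (\<Sum>i. c\<^sub>i u\<^sub>i)\<close> acts almost like the scalar \<open>(\<Sum>i. c\<^sub>i)\<close>, since every generator almost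
  fixes \<open>f\<close>. Hence \<open>(\<Sum>i. c\<^sub>i) \<tau>(f)\<close> is close to \<open>\<tau>(a f)\<close>, which is at most \<open>nrm a\<close>. The words and
  coefficients are fixed while the quality of \<open>f\<close> improves, so the total error \<open>K \<eta>\<close> vanishes in the limit.\<close>

theorem augmentation_bound:
  assumes S: "unitary_monoid S1" "unitary_monoid S2"
    and l1: "\<And>a. a \<in> averages S1 \<Longrightarrow> l1 \<le> (nrm a)\<^sup>2"
    and l2: "\<And>a. a \<in> averages S2 \<Longrightarrow> l2 \<le> (nrm a)\<^sup>2"
    and us: "\<And>i. i \<in> I \<Longrightarrow> set (us i) \<subseteq> S1 \<union> S2"
  shows "cmod (\<Sum>i\<in>I. c i) * ((l1 + l2 - 1) / 2) \<le> nrm (\<Sum>i\<in>I. scal (c i) * prod_list (us i))"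
proof -
  define a where "a = (\<Sum>i\<in>I. scal (c i) * prod_list (us i))"
  define s where "s = (\<Sum>i\<in>I. c i)"
  define K where "K = (\<Sum>i\<in>I. cmod (c i) * real (length (us i)))"
  have bound: "cmod s * ((l1 + l2 - 1) / 2) \<le> nrm a + (K + cmod s) * \<eta>" if "\<eta> > 0" for \<eta>
  proof -
    obtain f where f: "contractive f" "\<forall>u\<in>S1 \<union> S2. nrm (u * f - f) \<le> \<eta>"
        "(l1 + l2 - 1) / 2 - \<eta> \<le> Re (\<tau> f)"
      by (rule almost_fixed_by_both[OF S l1 l2 \<open>\<eta> > 0\<close>])
    have word: "nrm (prod_list xs * f - f) \<le> length xs * \<eta>" if "set xs \<subseteq> S1 \<union> S2" for xs
      using that
    proof (induction xs)
      case Nil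
      then show ?case by simp
    next
      case (Cons x xs)
      have "contractive x"
        using Cons.prems S unitary_contractive by (auto simp: unitary_monoid_def)
      then have "nrm (x * (prod_list xs * f - f)) \<le> length xs * \<eta>"
        using Cons contractive_left order_trans by (metis list.set_intros(2) subset_iff)
      moreover have "nrm (x * f - f) \<le> \<eta>"
        using Cons.prems f(2) by simp
      moreover have "prod_list (x # xs) * f - f = x * (prod_list xs * f - f) + (x * f - f)"
        by (simp add: algebra_simps)
      ultimately show ?case
        using nrm_triangle[of "x * (prod_list xs * f - f)" "x * f - f"] by (simp add: algebra_simps)
    qed
    have "a * f - scal s * f = (\<Sum>i\<in>I. scal (c i) * (prod_list (us i) * f - f))"
      by (simp add: a_def s_def scal_sum sum_distrib_right right_diff_distrib sum_subtractf mult.assoc)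
    then have "nrm (a * f - scal s * f) \<le> (\<Sum>i\<in>I. cmod (c i) * nrm (prod_list (us i) * f - f))"
      using nrm_sum[of "\<lambda>i. scal (c i) * (prod_list (us i) * f - f)" I] by (simp add: nrm_scal)
    also have "\<dots> \<le> (\<Sum>i\<in>I. cmod (c i) * (length (us i) * \<eta>))"
      by (intro sum_mono mult_left_mono word us) simp_all
    also have "\<dots> = K * \<eta>"
      by (simp add: K_def sum_distrib_right mult.assoc)
    finally have diff: "nrm (a * f - scal s * f) \<le> K * \<eta>" .
    have "cmod s * ((l1 + l2 - 1) / 2 - \<eta>) \<le> cmod s * Re (\<tau> f)"
      using f(3) by (simp add: mult_left_mono)
    also have "\<dots> \<le> cmod s * cmod (\<tau> f)"
      by (simp add: complex_Re_le_cmod mult_left_mono)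
    also have "\<dots> = cmod (\<tau> (scal s * f))"
      by (simp add: tau_scal norm_mult)
    also have "\<dots> = cmod (\<tau> (a * f) - \<tau> (a * f - scal s * f))"
      by (simp add: tau_diff)
    also have "\<dots> \<le> nrm (a * f) + nrm (a * f - scal s * f)"
      using norm_triangle_ineq4 cmod_tau_le add_mono order_trans by meson
    also have "\<dots> \<le> nrm a + K * \<eta>"
      using f(1) diff by (intro add_mono contractive_right)
    finally show ?thesis by (simp add: algebra_simps)
  qed
  have "K \<ge> 0" by (simp add: K_def sum_nonneg)
  show ?thesis
    unfolding a_def[symmetric] s_def[symmetric]
  proof (rule field_le_epsilon)
    fix e :: real assume "e > 0"
    have pos: "K + cmod s + 1 > 0" using \<open>K \<ge> 0\<close> by (simp add: add_nonneg_pos)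
    have "(K + cmod s) * (e / (K + cmod s + 1)) \<le> e"
      using pos \<open>e > 0\<close> by (simp add: field_simps)
    then show "cmod s * ((l1 + l2 - 1) / 2) \<le> nrm a + e"
      using bound[of "e / (K + cmod s + 1)"] divide_pos_pos[OF \<open>e > 0\<close> pos] by linarith
  qed
qed

end

section \<open>The tracial algebra of words of a group with a trace\<close>

text \<open>The algebra to which the estimate is applied is the algebra of words in the elements of the
  group rather than the group algebra. Words form a monoid on a whole type, so that
  \<open>\<Rightarrow>\<^sub>0\<close> provides the ring, whereas the group lives on a carrier set. Evaluating words in the group
  transports a trace to a tracial functional, and relations of the group hold modulo its kernel.\<close>

datatype 'x word = Word (letters: "'x list")

instantiation word :: (type) monoid_add
begin

definition "0 = Word []"

definition "v + w = Word (letters v @ letters w)"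

instance
  by standard (simp_all add: zero_word_def plus_word_def)

end

lemma letters_zero [simp]: "letters 0 = []"
  and letters_plus [simp]: "letters (v + w) = letters v @ letters w"
  by (simp_all add: zero_word_def plus_word_def)

lemma additive_eqI:
  fixes F F' :: "('x \<Rightarrow>\<^sub>0 'c::comm_monoid_add) \<Rightarrow> 'd::monoid_add"
  assumes "F 0 = F' 0" and "\<And>a b. F (a + b) = F a + F b" and "\<And>a b. F' (a + b) = F' a + F' b"
    and "\<And>k c. F (Poly_Mapping.single k c) = F' (Poly_Mapping.single k c)"
  shows "F a = F' a"
proof (induction a rule: update_induct)
  case const
  show ?case by (rule assms(1))
next
  case (update f k v)
  have "Poly_Mapping.update k v f = Poly_Mapping.single k v + f"
    using update.hyps by (intro poly_mapping_eqI)
      (auto simp: lookup_update lookup_add lookup_single when_def in_keys_iff)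
  then show ?case
    using update.IH assms by simp
qed

definition extend_additively :: "('x \<Rightarrow> 'c \<Rightarrow> 'd) \<Rightarrow> ('x \<Rightarrow>\<^sub>0 'c::zero) \<Rightarrow> 'd::comm_monoid_add" where
  "extend_additively h a = (\<Sum>k\<in>Poly_Mapping.keys a. h k (Poly_Mapping.lookup a k))"

lemma extend_additively_zero [simp]: "extend_additively h 0 = 0"
  by (simp add: extend_additively_def)

lemma extend_additively_superset:
  assumes "finite K" and "Poly_Mapping.keys a \<subseteq> K" and "\<And>k. h k 0 = 0"
  shows "extend_additively h a = (\<Sum>k\<in>K. h k (Poly_Mapping.lookup a k))"
  unfolding extend_additively_def using assms
  by (intro sum.mono_neutral_left) (auto simp: in_keys_iff)

lemma extend_additively_single:
  assumes "\<And>k. h k 0 = 0"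
  shows "extend_additively h (Poly_Mapping.single k c) = h k c"
  using extend_additively_superset[of "{k}" "Poly_Mapping.single k c" h] assms by simp

lemma extend_additively_add:
  fixes h :: "'x \<Rightarrow> 'c::comm_monoid_add \<Rightarrow> 'd::comm_monoid_add"
  assumes "\<And>k. h k 0 = 0" and "\<And>k c d. h k (c + d) = h k c + h k d"
  shows "extend_additively h (a + b) = extend_additively h a + extend_additively h b"
proof -
  let ?K = "Poly_Mapping.keys a \<union> Poly_Mapping.keys b"
  have "extend_additively h (a + b) = (\<Sum>k\<in>?K. h k (Poly_Mapping.lookup (a + b) k))"
    by (rule extend_additively_superset) (use assms keys_add[of a b] in auto)
  also have "\<dots> = (\<Sum>k\<in>?K. h k (Poly_Mapping.lookup a k)) + (\<Sum>k\<in>?K. h k (Poly_Mapping.lookup b k))"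
    by (simp add: lookup_add assms(2) sum.distrib)
  also have "\<dots> = extend_additively h a + extend_additively h b"
    using assms(1) by (simp add: extend_additively_superset[of ?K])
  finally show ?thesis .
qed

lemma positive_definite_finite:
  assumes "positive_definite G \<phi>" and "finite I" and "\<And>i. i \<in> I \<Longrightarrow> x i \<in> carrier G"
  shows "(\<Sum>i\<in>I. \<Sum>j\<in>I. cnj (c i) * c j * \<phi> (inv\<^bsub>G\<^esub> x i \<otimes>\<^bsub>G\<^esub> x j)) \<in> \<real>\<^sub>\<ge>\<^sub>0"
proof -
  obtain b where b: "bij_betw b {..<card I} I"
    using ex_bij_betw_nat_finite[OF assms(2)] by (auto simp: atLeast0LessThan)
  have "(\<Sum>i\<in>I. \<Sum>j\<in>I. cnj (c i) * c j * \<phi> (inv\<^bsub>G\<^esub> x i \<otimes>\<^bsub>G\<^esub> x j))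
      = (\<Sum>i<card I. \<Sum>j<card I. cnj (c (b i)) * c (b j) * \<phi> (inv\<^bsub>G\<^esub> x (b i) \<otimes>\<^bsub>G\<^esub> x (b j)))"
    by (simp add: sum.reindex_bij_betw[OF b, symmetric])
  moreover have "x \<circ> b \<in> {..<card I} \<rightarrow> carrier G"
    using bij_betwE[OF b] assms(3) by simp
  ultimately show ?thesis
    using assms(1)[unfolded positive_definite_def, rule_format, of "x \<circ> b" "card I" "c \<circ> b"]
    by simp
qed

text \<open>Positive definiteness of \<open>\<phi> - l\<close> on \<open>X\<close>: the constant \<open>l\<close> contributes \<open>l |\<Sum>i. c\<^sub>i|\<^sup>2\<close>.\<close>

definition trivial_part ::
    "('a, 'm) monoid_scheme \<Rightarrow> 'a set \<Rightarrow> ('a \<Rightarrow> complex) \<Rightarrow> real \<Rightarrow> bool" where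
  "trivial_part G X \<phi> l \<longleftrightarrow> (\<forall>(n::nat) x c. x \<in> {..<n} \<rightarrow> X \<longrightarrow>
     l * (cmod (\<Sum>i<n. c i))\<^sup>2
       \<le> Re (\<Sum>i<n. \<Sum>j<n. cnj (c i) * c j * \<phi> (inv\<^bsub>G\<^esub> x i \<otimes>\<^bsub>G\<^esub> x j)))"

lemma trivial_part_finite:
  assumes "trivial_part G X \<phi> l" and "finite I" and "x ` I \<subseteq> X"
  shows "l * (cmod (\<Sum>i\<in>I. c i))\<^sup>2
    \<le> Re (\<Sum>i\<in>I. \<Sum>j\<in>I. cnj (c i) * c j * \<phi> (inv\<^bsub>G\<^esub> x i \<otimes>\<^bsub>G\<^esub> x j))"
proof -
  obtain b where b: "bij_betw b {..<card I} I"
    using ex_bij_betw_nat_finite[OF assms(2)] by (auto simp: atLeast0LessThan)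
  have "x \<circ> b \<in> {..<card I} \<rightarrow> X"
    using bij_betwE[OF b] assms(3) by auto
  then have "l * (cmod (\<Sum>i<card I. c (b i)))\<^sup>2
      \<le> Re (\<Sum>i<card I. \<Sum>j<card I. cnj (c (b i)) * c (b j) * \<phi> (inv\<^bsub>G\<^esub> x (b i) \<otimes>\<^bsub>G\<^esub> x (b j)))"
    using assms(1)[unfolded trivial_part_def, rule_format, of "x \<circ> b" "card I" "c \<circ> b"]
    unfolding comp_def by blast
  then show ?thesis
    unfolding sum.reindex_bij_betw[OF b, symmetric] .
qed

locale group_trace = group G for G (structure) +
  fixes \<phi> :: "'a \<Rightarrow> complex"
  assumes trace: "\<phi> \<in> traces G"
begin

lemma pos_def: "positive_definite G \<phi>"
  and conj_inv: "g \<in> carrier G \<Longrightarrow> h \<in> carrier G \<Longrightarrow> \<phi> (h \<otimes> g \<otimes> inv h) = \<phi> g"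
  and at_one [simp]: "\<phi> \<one> = 1"
  using trace by (auto simp: traces_def)

lemma trace_commute:
  assumes "g \<in> carrier G" "h \<in> carrier G"
  shows "\<phi> (g \<otimes> h) = \<phi> (h \<otimes> g)"
proof -
  have "inv g \<otimes> (g \<otimes> h) \<otimes> inv (inv g) = h \<otimes> g"
    using assms by (simp flip: m_assoc)
  then show ?thesis
    using conj_inv[of "g \<otimes> h" "inv g"] assms by simp
qed

text \<open>Positive definiteness for the pair \<open>\<one>\<close>, \<open>g\<close>. Suitable coefficients yield both the symmetry of \<open>\<phi>\<close>
  under inversion and its boundedness.\<close>

lemma two_point:
  assumes g: "g \<in> carrier G"
  shows "cnj c * c + cnj d * d + cnj c * d * \<phi> g + cnj d * c * \<phi> (inv g) \<in> \<real>\<^sub>\<ge>\<^sub>0"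
  using positive_definite_finite[OF pos_def, of "{False, True}" "\<lambda>b. if b then g else \<one>"
      "\<lambda>b. if b then d else c"] g
  by (simp add: algebra_simps)

lemma at_inv:
  assumes g: "g \<in> carrier G"
  shows "\<phi> (inv g) = cnj (\<phi> g)"
proof -
  have "Im (\<phi> g + \<phi> (inv g)) = 0"
    using two_point[OF g, of 1 1] by (auto simp: complex_nonneg_Reals_iff)
  moreover have "Re (\<phi> g - \<phi> (inv g)) = 0"
    using two_point[OF g, of 1 \<i>] by (auto simp: complex_nonneg_Reals_iff)
  ultimately show ?thesis
    by (simp add: complex_eq_iff)
qed

lemma cmod_le_one:
  assumes g: "g \<in> carrier G"
  shows "cmod (\<phi> g) \<le> 1"
proof (cases "\<phi> g = 0")
  case False
  \<comment> \<open>With this phase both mixed terms equal \<open>-|\<phi>(g)|\<close>.\<close>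
  define u where "u = - cnj (\<phi> g) / of_real (cmod (\<phi> g))"
  have "u * \<phi> g = - of_real (cmod (\<phi> g))"
    using False complex_norm_square[of "\<phi> g"]
    by (simp add: u_def field_simps power2_eq_square)
  moreover have "cnj u * u = 1"
    using False complex_norm_square[of "\<phi> g"]
    by (simp add: u_def field_simps power2_eq_square)
  moreover have "cnj u * cnj (\<phi> g) = - of_real (cmod (\<phi> g))"
    using arg_cong[OF calculation(1), of cnj] by simp
  ultimately have "1 + 1 - of_real (cmod (\<phi> g)) - of_real (cmod (\<phi> g)) \<in> (\<real>\<^sub>\<ge>\<^sub>0 :: complex set)"
    using two_point[OF g, of 1 u] at_inv[OF g] by simp
  then show ?thesis
    by (simp add: complex_nonneg_Reals_iff)
qed simp

text \<open>Letters outside the carrier count as the identity, so that every word has a value in the group.\<close>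

definition letter :: "'a \<Rightarrow> 'a" where
  "letter x = (if x \<in> carrier G then x else \<one>)"

definition eval :: "'a word \<Rightarrow> 'a" where
  "eval w = foldr (\<lambda>x y. letter x \<otimes> y) (letters w) \<one>"

lemma letter_closed [simp]: "letter x \<in> carrier G"
  by (simp add: letter_def)

lemma foldr_closed [simp]: "foldr (\<lambda>x y. letter x \<otimes> y) xs \<one> \<in> carrier G"
  by (induction xs) simp_all

lemma eval_closed [simp]: "eval w \<in> carrier G"
  by (simp add: eval_def)

lemma eval_zero [simp]: "eval 0 = \<one>"
  by (simp add: eval_def)

lemma eval_plus [simp]: "eval (v + w) = eval v \<otimes> eval w"
proof -
  have "foldr (\<lambda>x y. letter x \<otimes> y) (xs @ ys) \<one> =
      foldr (\<lambda>x y. letter x \<otimes> y) xs \<one> \<otimes> foldr (\<lambda>x y. letter x \<otimes> y) ys \<one>" for xs ys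
    by (induction xs) (simp_all add: m_assoc del: foldr_append)
  then show ?thesis by (simp add: eval_def del: foldr_append)
qed

text \<open>An involution on the whole type, as \<open>word_inv\<close> has to be one.\<close>

definition letter_inv :: "'a \<Rightarrow> 'a" where
  "letter_inv x = (if x \<in> carrier G then inv x else x)"

definition word_inv :: "'a word \<Rightarrow> 'a word" where
  "word_inv w = Word (rev (map letter_inv (letters w)))"

lemma word_inv_word_inv [simp]: "word_inv (word_inv w) = w"
proof -
  have "letter_inv \<circ> letter_inv = id" by (auto simp: letter_inv_def)
  then show ?thesis by (simp add: word_inv_def rev_map)
qed

lemma word_inv_plus: "word_inv (v + w) = word_inv w + word_inv v"
  by (simp add: word_inv_def plus_word_def)

lemma word_inv_zero [simp]: "word_inv 0 = 0"
  by (simp add: word_inv_def zero_word_def)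

lemma eval_word_inv [simp]: "eval (word_inv w) = inv (eval w)"
proof -
  have "eval (word_inv (Word xs)) = inv (eval (Word xs))" for xs
  proof (induction xs)
    case Nil
    then show ?case by (simp flip: zero_word_def)
  next
    case (Cons x xs)
    have "Word (x # xs) = Word [x] + Word xs" by (simp add: plus_word_def)
    moreover have "eval (word_inv (Word [x])) = inv (eval (Word [x]))"
      by (simp add: word_inv_def letter_inv_def eval_def letter_def)
    ultimately show ?case
      using Cons by (simp add: word_inv_plus inv_mult_group)
  qed
  from this[of "letters w"] show ?thesis by simp
qed

definition star :: "('a word \<Rightarrow>\<^sub>0 complex) \<Rightarrow> ('a word \<Rightarrow>\<^sub>0 complex)" where
  "star = extend_additively (\<lambda>w c. Poly_Mapping.single (word_inv w) (cnj c))"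

definition \<tau> :: "('a word \<Rightarrow>\<^sub>0 complex) \<Rightarrow> complex" where
  "\<tau> = extend_additively (\<lambda>w c. c * \<phi> (eval w))"

abbreviation scal :: "complex \<Rightarrow> ('a word \<Rightarrow>\<^sub>0 complex)" where
  "scal \<equiv> Poly_Mapping.single 0"

lemma star_single: "star (Poly_Mapping.single w c) = Poly_Mapping.single (word_inv w) (cnj c)"
  by (simp add: star_def extend_additively_single)

lemma \<tau>_single: "\<tau> (Poly_Mapping.single w c) = c * \<phi> (eval w)"
  by (simp add: \<tau>_def extend_additively_single)

lemma star_add: "star (a + b) = star a + star b"
  unfolding star_def by (rule extend_additively_add) (simp_all add: single_add)

lemma \<tau>_add: "\<tau> (a + b) = \<tau> a + \<tau> b"
  unfolding \<tau>_def by (rule extend_additively_add) (simp_all add: distrib_right)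

lemma star_zero: "star 0 = 0" and \<tau>_zero: "\<tau> 0 = 0"
  by (simp_all add: star_def \<tau>_def)

lemmas additive_simps = star_single \<tau>_single star_add \<tau>_add star_zero \<tau>_zero distrib_left distrib_right

lemma \<tau>_star_mult_self:
  "\<tau> (star a * a) = (\<Sum>v\<in>Poly_Mapping.keys a. \<Sum>w\<in>Poly_Mapping.keys a.
     cnj (Poly_Mapping.lookup a v) * Poly_Mapping.lookup a w * \<phi> (inv (eval v) \<otimes> eval w))"
proof -
  have a: "a = (\<Sum>w\<in>Poly_Mapping.keys a. Poly_Mapping.single w (Poly_Mapping.lookup a w))"
    by (rule poly_mapping_eqI) (auto simp: lookup_sum lookup_single when_def in_keys_iff)
  have star_sum: "star (sum x I) = (\<Sum>i\<in>I. star (x i))" for x and I :: "'a word set"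
    by (induction I rule: infinite_finite_induct) (simp_all add: additive_simps)
  have \<tau>_sum: "\<tau> (sum x I) = (\<Sum>i\<in>I. \<tau> (x i))" for x and I :: "'a word set"
    by (induction I rule: infinite_finite_induct) (simp_all add: additive_simps)
  have "star a = (\<Sum>v\<in>Poly_Mapping.keys a. Poly_Mapping.single (word_inv v) (cnj (Poly_Mapping.lookup a v)))"
    by (simp add: star_def extend_additively_def)
  then have "star a * a = (\<Sum>v\<in>Poly_Mapping.keys a. \<Sum>w\<in>Poly_Mapping.keys a.
      Poly_Mapping.single (word_inv v + w) (cnj (Poly_Mapping.lookup a v) * Poly_Mapping.lookup a w))"
    by (subst (2) a) (simp add: sum_product mult_single)
  then show ?thesis
    by (simp add: \<tau>_sum \<tau>_single)
qed

sublocale tracial_star_algebra star scal \<tau>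
proof
  fix a b :: "'a word \<Rightarrow>\<^sub>0 complex" and c d :: complex
  show "star (a + b) = star a + star b" by (rule star_add)
  show "\<tau> (a + b) = \<tau> a + \<tau> b" by (rule \<tau>_add)
  show "star (a * b) = star b * star a"
  proof (rule additive_eqI[of "\<lambda>a. star (a * b)" "\<lambda>a. star b * star a"])
    fix k c
    show "star (Poly_Mapping.single k c * b) = star b * star (Poly_Mapping.single k c)"
      by (rule additive_eqI[of "\<lambda>b. star (Poly_Mapping.single k c * b)"])
        (simp_all add: additive_simps mult_single word_inv_plus mult.commute)
  qed (simp_all add: additive_simps)
  show "star (star a) = a"
    by (rule additive_eqI[of "\<lambda>a. star (star a)" "\<lambda>a. a"]) (simp_all add: additive_simps)
  show "star (scal c) = scal (cnj c)" by (simp add: star_single)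
  show "scal (c + d) = scal c + scal d" by (rule single_add)
  show "scal (c * d) = scal c * scal d" by (simp add: mult_single)
  show "scal 1 = (1 :: 'a word \<Rightarrow>\<^sub>0 complex)" by (rule single_one)
  show "scal c * a = a * scal c"
    by (rule additive_eqI[of "\<lambda>a. scal c * a"]) (simp_all add: distrib_left distrib_right mult_single mult.commute)
  show "\<tau> (scal c * a) = c * \<tau> a"
    by (rule additive_eqI[of "\<lambda>a. \<tau> (scal c * a)"]) (simp_all add: additive_simps mult_single)
  show "\<tau> (a * b) = \<tau> (b * a)"
  proof (rule additive_eqI[of "\<lambda>a. \<tau> (a * b)" "\<lambda>a. \<tau> (b * a)"])
    fix k c
    show "\<tau> (Poly_Mapping.single k c * b) = \<tau> (b * Poly_Mapping.single k c)"
      by (rule additive_eqI[of "\<lambda>b. \<tau> (Poly_Mapping.single k c * b)"])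
        (simp_all add: additive_simps mult_single mult.commute trace_commute[of "eval k"])
  qed (simp_all add: additive_simps)
  show "\<tau> (star a) = cnj (\<tau> a)"
    by (rule additive_eqI[of "\<lambda>a. \<tau> (star a)" "\<lambda>a. cnj (\<tau> a)"]) (simp_all add: additive_simps at_inv)
  show "0 \<le> Re (\<tau> (star a * a))"
    using positive_definite_finite[OF pos_def, of "Poly_Mapping.keys a" eval "Poly_Mapping.lookup a"]
    by (simp add: \<tau>_star_mult_self complex_nonneg_Reals_iff)
  show "\<tau> 1 = 1"
    using \<tau>_single[of 0 1] by simp
qed

lemma unitary_single: "unitary (Poly_Mapping.single w 1)"
  unfolding unitary_def
proof (intro conjI allI)
  fix b
  show "\<tau> (star (Poly_Mapping.single w 1) * Poly_Mapping.single w 1 * b) = \<tau> b"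
    by (rule additive_eqI[of "\<lambda>b. \<tau> (star (Poly_Mapping.single w 1) * Poly_Mapping.single w 1 * b)"])
      (simp_all add: additive_simps mult_single)
  show "\<tau> (Poly_Mapping.single w 1 * star (Poly_Mapping.single w 1) * b) = \<tau> b"
    by (rule additive_eqI[of "\<lambda>b. \<tau> (Poly_Mapping.single w 1 * star (Poly_Mapping.single w 1) * b)"])
      (simp_all add: additive_simps mult_single)
qed


lemma star_sum: "star (sum x I) = (\<Sum>i\<in>I. star (x i))"
  by (induction I rule: infinite_finite_induct) (simp_all add: additive_simps)

text \<open>The linear functional that takes the value \<open>1\<close> on every word.\<close>

definition augmentation :: "('a word \<Rightarrow>\<^sub>0 complex) \<Rightarrow> complex" where
  "augmentation = extend_additively (\<lambda>w c. c)"

lemma augmentation_add: "augmentation (a + b) = augmentation a + augmentation b"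
  unfolding augmentation_def by (rule extend_additively_add) simp_all

lemma augmentation_single: "augmentation (Poly_Mapping.single w c) = c"
  by (simp add: augmentation_def extend_additively_single)

lemma augmentation_zero: "augmentation 0 = 0"
  by (simp add: augmentation_def)

lemma augmentation_scal: "augmentation (scal c * a) = c * augmentation a"
  by (rule additive_eqI[of "\<lambda>a. augmentation (scal c * a)"])
    (simp_all add: additive_simps mult_single augmentation_add augmentation_single augmentation_zero)

definition words_over :: "'a set \<Rightarrow> ('a word \<Rightarrow>\<^sub>0 complex) set" where
  "words_over X = {Poly_Mapping.single w 1 |w. set (letters w) \<subseteq> X}"

lemma unitary_monoid_words_over:
  assumes "subgroup X G"
  shows "unitary_monoid (words_over X)"
  unfolding unitary_monoid_def
proof (intro conjI ballI)
  have "Poly_Mapping.single 0 1 \<in> words_over X"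
    unfolding words_over_def by (intro CollectI exI[of _ 0]) simp
  then show "words_over X \<noteq> {}" by blast
next
  fix s assume "s \<in> words_over X"
  then obtain v where s: "s = Poly_Mapping.single v 1" "set (letters v) \<subseteq> X"
    by (auto simp: words_over_def)
  show "unitary s" using s unitary_single by simp
  have "letter_inv x \<in> X" if "x \<in> X" for x
    using that assms subgroup.m_inv_closed subgroup.mem_carrier by (fastforce simp: letter_inv_def)
  then have "set (letters (word_inv v)) \<subseteq> X"
    using s(2) by (auto simp: word_inv_def)
  then show "star s \<in> words_over X"
    using s(1) by (auto simp: words_over_def star_single)
  fix t assume "t \<in> words_over X"
  then obtain w where "t = Poly_Mapping.single w 1" "set (letters w) \<subseteq> X"
    by (auto simp: words_over_def)
  then show "s * t \<in> words_over X"
    using s unfolding words_over_def by (intro CollectI exI[of _ "v + w"]) (simp add: mult_single)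
qed

lemma eval_in_subgroup:
  assumes "subgroup X G" and "set (letters w) \<subseteq> X"
  shows "eval w \<in> X"
proof -
  have "foldr (\<lambda>x y. letter x \<otimes> y) xs \<one> \<in> X" if "set xs \<subseteq> X" for xs
    using that assms(1)
    by (induction xs) (auto simp: letter_def subgroup.one_closed subgroup.m_closed)
  then show ?thesis using assms(2) by (simp add: eval_def)
qed

lemma averages_words_over:
  assumes "a \<in> averages (words_over X)"
  shows "augmentation a = 1" and "w \<in> Poly_Mapping.keys a \<Longrightarrow> set (letters w) \<subseteq> X"
proof -
  have "augmentation a = 1 \<and> (\<forall>w\<in>Poly_Mapping.keys a. set (letters w) \<subseteq> X)"
    using assms
  proof induction
    case (base s)
    then show ?case by (auto simp: words_over_def augmentation_single)
  next
    case (midpoint a b)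
    have "Poly_Mapping.keys (scal (1/2) * (a + b)) \<subseteq> Poly_Mapping.keys a \<union> Poly_Mapping.keys b"
      using keys_mult[of "scal (1/2)" "a + b"] keys_add[of a b] by auto
    then show ?case
      using midpoint.IH by (auto simp: augmentation_scal augmentation_add)
  qed
  then show "augmentation a = 1" and "w \<in> Poly_Mapping.keys a \<Longrightarrow> set (letters w) \<subseteq> X"
    by blast+
qed

text \<open>An average has augmentation \<open>1\<close>, so the square of its norm is at least the trivial part.\<close>

lemma averages_lower_bound:
  assumes "subgroup X G" and "trivial_part G X \<phi> l" and a: "a \<in> averages (words_over X)"
  shows "l \<le> (nrm a)\<^sup>2"
proof -
  have "(\<Sum>w\<in>Poly_Mapping.keys a. Poly_Mapping.lookup a w) = 1"
    using averages_words_over(1)[OF a] by (simp add: augmentation_def extend_additively_def)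
  moreover have "eval ` Poly_Mapping.keys a \<subseteq> X"
    using averages_words_over(2)[OF a] eval_in_subgroup[OF assms(1)] by blast
  ultimately show ?thesis
    using trivial_part_finite[OF assms(2), of "Poly_Mapping.keys a" eval "Poly_Mapping.lookup a"]
    by (simp add: nrm_power2 \<tau>_star_mult_self)
qed

text \<open>Writing the group elements \<open>x\<^sub>i\<close> as words in the two subgroups turns \<open>(nrm (\<Sum>i. c\<^sub>i x\<^sub>i))\<^sup>2\<close> into the positive
  definite form of \<open>\<phi>\<close>, and \<open>augmentation_bound\<close> is then the claim.\<close>

theorem trivial_part_of_generated:
  assumes X: "subgroup X1 G" "subgroup X2 G"
    and l: "trivial_part G X1 \<phi> l1" "trivial_part G X2 \<phi> l2" "l1 + l2 \<ge> 1"
    and gen: "\<forall>g\<in>carrier G. \<exists>xs. set xs \<subseteq> X1 \<union> X2 \<and> g = foldr (\<otimes>) xs \<one>"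
  shows "trivial_part G (carrier G) \<phi> (((l1 + l2 - 1) / 2)\<^sup>2)"
  unfolding trivial_part_def
proof (intro allI impI)
  fix n :: nat and x and c :: "nat \<Rightarrow> complex"
  assume x_in: "x \<in> {..<n} \<rightarrow> carrier G"
  define I where "I = {..<n}"
  have "\<forall>i. \<exists>ys. i \<in> I \<longrightarrow> set ys \<subseteq> X1 \<union> X2 \<and> x i = foldr (\<otimes>) ys \<one>"
    using gen x_in unfolding I_def by (meson PiE)
  then obtain xs where xs: "\<And>i. i \<in> I \<Longrightarrow> set (xs i) \<subseteq> X1 \<union> X2"
      and x: "\<And>i. i \<in> I \<Longrightarrow> x i = foldr (\<otimes>) (xs i) \<one>"
    by metis
  let ?u = "\<lambda>x. Poly_Mapping.single (Word [x]) (1 :: complex)"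
  define a where "a = (\<Sum>i\<in>I. scal (c i) * prod_list (map ?u (xs i)))"
  have prod: "prod_list (map ?u ys) = Poly_Mapping.single (Word ys) 1" for ys
    by (induction ys) (simp_all add: mult_single plus_word_def flip: zero_word_def)
  have "X1 \<subseteq> carrier G" "X2 \<subseteq> carrier G"
    using X subgroup.subset by blast+
  then have eval_xs: "eval (Word (xs i)) = x i" if "i \<in> I" for i
  proof -
    have "foldr (\<lambda>x y. letter x \<otimes> y) ys \<one> = foldr (\<otimes>) ys \<one>" if "set ys \<subseteq> carrier G" for ys
      using that by (induction ys) (auto simp: letter_def)
    from this[of "xs i"] show ?thesis
      using x[OF that] xs[OF that] \<open>X1 \<subseteq> carrier G\<close> \<open>X2 \<subseteq> carrier G\<close>
      by (auto simp: eval_def)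
  qed
  have a: "a = (\<Sum>i\<in>I. Poly_Mapping.single (Word (xs i)) (c i))"
    by (simp add: a_def prod mult_single)
  have "star a * a = (\<Sum>i\<in>I. \<Sum>j\<in>I.
      Poly_Mapping.single (word_inv (Word (xs i)) + Word (xs j)) (cnj (c i) * c j))"
    by (simp add: a star_sum star_single sum_product mult_single)
  then have "(nrm a)\<^sup>2 = Re (\<Sum>i\<in>I. \<Sum>j\<in>I. cnj (c i) * c j * \<phi> (inv x i \<otimes> x j))"
    by (simp add: nrm_power2 tau_sum \<tau>_single eval_xs)
  moreover have u: "?u y \<in> words_over X" if "y \<in> X" for y X
    unfolding words_over_def using that by (intro CollectI exI[of _ "Word [y]"]) simp
  have "cmod (\<Sum>i\<in>I. c i) * ((l1 + l2 - 1) / 2) \<le> nrm a"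
    unfolding a_def
  proof (rule augmentation_bound[OF X[THEN unitary_monoid_words_over]])
    show "set (map ?u (xs i)) \<subseteq> words_over X1 \<union> words_over X2" if "i \<in> I" for i
      using xs[OF that] u by auto
  qed (use X l averages_lower_bound in blast)+
  then have "(cmod (\<Sum>i\<in>I. c i) * ((l1 + l2 - 1) / 2))\<^sup>2 \<le> (nrm a)\<^sup>2"
    using l(3) by (intro power_mono) simp_all
  ultimately show "((l1 + l2 - 1) / 2)\<^sup>2 * (cmod (\<Sum>i<n. c i))\<^sup>2
      \<le> Re (\<Sum>i<n. \<Sum>j<n. cnj (c i) * c j * \<phi> (inv x i \<otimes> x j))"
    unfolding I_def[symmetric]
    by (simp only: power_mult_distrib mult.commute[of "(cmod (\<Sum>i\<in>I. c i))\<^sup>2"])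
qed

end

section \<open>Compactness of the traces and property (ET)\<close>

text \<open>Each of the conditions on a trace is a closed condition on finitely many coordinates.\<close>

lemma closed_traces: "closed (traces G)"
proof -
  have coord: "continuous_on UNIV (\<lambda>\<phi>. \<phi> x :: complex)" for x :: 'a
    by simp
  have "traces G = {\<phi>. \<forall>x. x \<notin> carrier G \<longrightarrow> \<phi> x = undefined}
      \<inter> {\<phi>. \<forall>(n::nat) g c. g \<in> {..<n} \<rightarrow> carrier G \<longrightarrow>
          (\<Sum>i<n. \<Sum>j<n. cnj (c i) * c j * \<phi> (inv\<^bsub>G\<^esub> g i \<otimes>\<^bsub>G\<^esub> g j)) \<in> \<real>\<^sub>\<ge>\<^sub>0}
      \<inter> {\<phi>. \<forall>g h. g \<in> carrier G \<longrightarrow> h \<in> carrier G \<longrightarrow> \<phi> (h \<otimes>\<^bsub>G\<^esub> g \<otimes>\<^bsub>G\<^esub> inv\<^bsub>G\<^esub> h) = \<phi> g}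
      \<inter> {\<phi>. \<phi> \<one>\<^bsub>G\<^esub> = 1}"
    unfolding traces_def positive_definite_def extensional_def by blast
  moreover have "closed {\<phi>. \<forall>(n::nat) g c. g \<in> {..<n} \<rightarrow> carrier G \<longrightarrow>
      (\<Sum>i<n. \<Sum>j<n. cnj (c i) * c j * \<phi> (inv\<^bsub>G\<^esub> g i \<otimes>\<^bsub>G\<^esub> g j)) \<in> \<real>\<^sub>\<ge>\<^sub>0}"
  proof (intro closed_Collect_all closed_Collect_imp)
    fix n :: nat and g :: "nat \<Rightarrow> 'a" and c :: "nat \<Rightarrow> complex"
    let ?q = "\<lambda>\<phi>. \<Sum>i<n. \<Sum>j<n. cnj (c i) * c j * \<phi> (inv\<^bsub>G\<^esub> g i \<otimes>\<^bsub>G\<^esub> g j)"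
    have "continuous_on UNIV ?q"
      by (intro continuous_on_sum continuous_on_mult continuous_on_const coord)
    then have "closed (?q -` \<real>\<^sub>\<ge>\<^sub>0)"
      by (simp add: closed_vimage)
    then show "closed {\<phi>. ?q \<phi> \<in> \<real>\<^sub>\<ge>\<^sub>0}"
      by (simp add: vimage_def)
  qed simp
  moreover have "closed {\<phi> :: 'a \<Rightarrow> complex. \<forall>x. x \<notin> carrier G \<longrightarrow> \<phi> x = undefined}"
    by (intro closed_Collect_all closed_Collect_imp closed_Collect_eq coord continuous_on_const) simp
  moreover have "closed {\<phi> :: 'a \<Rightarrow> complex. \<forall>g h. g \<in> carrier G \<longrightarrow> h \<in> carrier G \<longrightarrow>
      \<phi> (h \<otimes>\<^bsub>G\<^esub> g \<otimes>\<^bsub>G\<^esub> inv\<^bsub>G\<^esub> h) = \<phi> g}"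
    by (intro closed_Collect_all closed_Collect_imp closed_Collect_eq coord) simp_all
  moreover have "closed {\<phi> :: 'a \<Rightarrow> complex. \<phi> \<one>\<^bsub>G\<^esub> = 1}"
    by (intro closed_Collect_eq coord continuous_on_const)
  ultimately show ?thesis
    by (simp only: closed_Int)
qed

lemma compact_traces:
  assumes "group G"
  shows "compact (traces G)"
proof -
  let ?B = "\<lambda>x. if x \<in> carrier G then cball 0 1 else {undefined :: complex}"
  have "compactin (product_topology (\<lambda>_. euclidean) UNIV) (Pi\<^sub>E UNIV ?B)"
    by (simp add: compactin_PiE)
  then have "compact (Pi\<^sub>E UNIV ?B)"
    by (simp add: euclidean_product_topology)
  moreover have "traces G \<subseteq> Pi\<^sub>E UNIV ?B"
  proof
    fix \<phi> assume \<phi>: "\<phi> \<in> traces G"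
    then interpret group_trace G \<phi>
      using assms by (simp add: group_trace_def group_trace_axioms_def)
    show "\<phi> \<in> Pi\<^sub>E UNIV ?B"
      using \<phi> cmod_le_one by (auto simp: traces_def extensional_def)
  qed
  ultimately show ?thesis
    using compact_Int_closed[OF _ closed_traces[of G]] by (metis inf.absorb2)
qed

lemma trivial_character_trace:
  assumes "group G"
  shows "trivial_character G \<in> traces G"
proof -
  interpret group G by fact
  have "positive_definite G (trivial_character G)"
    unfolding positive_definite_def
  proof (intro allI impI)
    fix n :: nat and g and c :: "nat \<Rightarrow> complex"
    assume g: "g \<in> {..<n} \<rightarrow> carrier G"
    have "(\<Sum>i<n. \<Sum>j<n. cnj (c i) * c j * trivial_character G (inv\<^bsub>G\<^esub> g i \<otimes>\<^bsub>G\<^esub> g j))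
        = (\<Sum>i<n. \<Sum>j<n. cnj (c i) * c j)"
      by (intro sum.cong refl) (use g in \<open>auto simp: trivial_character_def Pi_iff\<close>)
    also have "\<dots> = cnj (\<Sum>i<n. c i) * (\<Sum>i<n. c i)"
      by (simp add: sum_product)
    also have "\<dots> = of_real ((cmod (\<Sum>i<n. c i))\<^sup>2)"
      by (metis complex_norm_square mult.commute)
    finally show "(\<Sum>i<n. \<Sum>j<n. cnj (c i) * c j * trivial_character G (inv\<^bsub>G\<^esub> g i \<otimes>\<^bsub>G\<^esub> g j)) \<in> \<real>\<^sub>\<ge>\<^sub>0"
      by simp
  qed
  then show ?thesis
    by (auto simp: traces_def trivial_character_def)
qed

text \<open>Traces have values in the closed unit disc, and \<open>1\<close> is an extreme point of the disc.\<close>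

lemma trivial_character_is_character:
  assumes "group G"
  shows "trivial_character G \<in> characters G"
proof -
  have "\<phi>1 = trivial_character G \<and> \<phi>2 = trivial_character G"
    if tr: "\<phi>1 \<in> traces G" "\<phi>2 \<in> traces G" and t: "0 < t" "t < 1"
      and eq: "\<forall>g\<in>carrier G. trivial_character G g = of_real (1 - t) * \<phi>1 g + of_real t * \<phi>2 g"
    for \<phi>1 \<phi>2 and t :: real
  proof -
    interpret T1: group_trace G \<phi>1
      using assms tr by (simp add: group_trace_def group_trace_axioms_def)
    interpret T2: group_trace G \<phi>2
      using assms tr by (simp add: group_trace_def group_trace_axioms_def)
    have "\<phi>1 g = 1 \<and> \<phi>2 g = 1" if g: "g \<in> carrier G" for g
    proof -
      have 1: "1 = (1 - t) * Re (\<phi>1 g) + t * Re (\<phi>2 g)"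
        using arg_cong[OF bspec[OF eq g], of Re] g by (simp add: trivial_character_def)
      have le: "Re (\<phi>1 g) \<le> 1" "Re (\<phi>2 g) \<le> 1"
        using T1.cmod_le_one[OF g] T2.cmod_le_one[OF g] complex_Re_le_cmod order_trans by blast+
      have nonneg: "0 \<le> (1 - t) * (1 - Re (\<phi>1 g))" "0 \<le> t * (1 - Re (\<phi>2 g))"
        using le t by simp_all
      moreover have "(1 - t) * (1 - Re (\<phi>1 g)) + t * (1 - Re (\<phi>2 g)) = 0"
        using 1 by (simp add: algebra_simps)
      ultimately have "(1 - t) * (1 - Re (\<phi>1 g)) = 0" "t * (1 - Re (\<phi>2 g)) = 0"
        by linarith+
      then have re: "Re (\<phi>1 g) = 1" "Re (\<phi>2 g) = 1"
        using t by simp_all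
      have im: "Im z = 0" if "Re z = 1" "cmod z \<le> 1" for z
      proof -
        have "(cmod z)\<^sup>2 \<le> 1"
          using that(2) by (simp add: power_le_one)
        then show ?thesis
          using that(1) by (simp add: cmod_power2)
      qed
      show ?thesis
        using re im[OF re(1) T1.cmod_le_one[OF g]] im[OF re(2) T2.cmod_le_one[OF g]]
        by (simp add: complex_eq_iff)
    qed
    then show ?thesis
      using tr by (auto simp: traces_def trivial_character_def extensional_def restrict_def fun_eq_iff)
  qed
  then show ?thesis
    unfolding characters_def using trivial_character_trace[OF assms] by blast
qed

lemma extreme_trace_is_character:
  assumes "extreme_subset (traces G) {\<xi>}"
  shows "\<xi> \<in> characters G"
proof -
  have "\<phi>1 = \<phi>2"
    if tr: "\<phi>1 \<in> traces G" "\<phi>2 \<in> traces G" and t: "0 < t" "t < 1"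
      and eq: "\<forall>g\<in>carrier G. \<xi> g = of_real (1 - t) * \<phi>1 g + of_real t * \<phi>2 g"
    for \<phi>1 \<phi>2 and t :: real
  proof -
    have "\<xi> \<in> traces G" using extreme_subset_subset[OF assms] by simp
    then have "\<xi> x = of_real (1 - t) * \<phi>1 x + of_real t * \<phi>2 x" for x
      using eq tr by (cases "x \<in> carrier G") (auto simp: traces_def extensional_def algebra_simps)
    then have "convex_comb t \<xi> \<phi>1 \<phi>2" using t by (simp add: convex_comb_def)
    then show ?thesis using assms tr unfolding extreme_subset_def by blast
  qed
  then show ?thesis
    using extreme_subset_subset[OF assms] unfolding characters_def by blast
qed

lemma affine_const: "affine_functional (\<lambda>_. r)"
  by (simp add: affine_functional_def algebra_simps)

lemma affine_add:
  assumes "affine_functional A" and "affine_functional B"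
  shows "affine_functional (\<lambda>\<phi>. A \<phi> + B \<phi>)"
  unfolding affine_functional_def
proof (intro conjI allI impI)
  show "continuous_on UNIV (\<lambda>\<phi>. A \<phi> + B \<phi>)"
    using assms by (simp add: affine_functional_def continuous_on_add)
  fix t and \<phi> \<phi>1 \<phi>2 :: "'a \<Rightarrow> complex" assume "convex_comb t \<phi> \<phi>1 \<phi>2"
  then show "A \<phi> + B \<phi> = (1 - t) * (A \<phi>1 + B \<phi>1) + t * (A \<phi>2 + B \<phi>2)"
    using assms[THEN affine_functionalD] by (simp add: algebra_simps)
qed

lemma affine_cmult:
  assumes "affine_functional A"
  shows "affine_functional (\<lambda>\<phi>. r * A \<phi>)"
  unfolding affine_functional_def
proof (intro conjI allI impI)
  show "continuous_on UNIV (\<lambda>\<phi>. r * A \<phi>)"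
    using assms by (simp add: affine_functional_def continuous_on_mult_left)
  fix t and \<phi> \<phi>1 \<phi>2 :: "'a \<Rightarrow> complex" assume "convex_comb t \<phi> \<phi>1 \<phi>2"
  then have A: "A \<phi> = (1 - t) * A \<phi>1 + t * A \<phi>2"
    by (rule affine_functionalD[OF assms])
  show "r * A \<phi> = (1 - t) * (r * A \<phi>1) + t * (r * A \<phi>2)"
    unfolding A by (simp add: algebra_simps)
qed

lemma affine_sum:
  assumes "\<And>i. i \<in> I \<Longrightarrow> affine_functional (A i)"
  shows "affine_functional (\<lambda>\<phi>. \<Sum>i\<in>I. A i \<phi>)"
  using assms
  by (induction I rule: infinite_finite_induct) (simp_all add: affine_const affine_add)

text \<open>A neighbourhood of \<open>1\<close> restricts only finitely many values, so a character outside it satisfies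
  \<open>|1 - \<xi>(g)| \<ge> \<epsilon>\<close> for some \<open>g\<close> in a fixed finite set. As \<open>|\<xi>(g)| \<le> 1\<close>, the real part of \<open>1 - \<xi>(g)\<close> is at least
  \<open>\<epsilon>\<^sup>2/2\<close>. Real parts are used because they depend affinely on \<open>\<xi>\<close>.\<close>

lemma ET_uniform_gap:
  assumes "group G" and "property_ET G"
  obtains K \<kappa> where "finite K" and "K \<subseteq> carrier G" and "\<kappa> > 0"
    and "\<forall>\<xi>\<in>characters G. \<xi> \<noteq> trivial_character G \<longrightarrow> \<kappa> \<le> (\<Sum>g\<in>K. 1 - Re (\<xi> g))"
proof -
  let ?e = "trivial_character G"
  obtain T where T: "open T" "T \<inter> characters G = {?e}"
    using assms(2) unfolding property_ET_def isolated_in_def by blast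
  have "openin (product_topology (\<lambda>_. euclidean) UNIV) T" "?e \<in> T"
    using T by (auto simp: euclidean_product_topology)
  from product_topology_open_contains_basis[OF this]
  obtain X where X: "?e \<in> Pi\<^sub>E UNIV X" "\<And>i. open (X i)" "finite {i. X i \<noteq> UNIV}" "Pi\<^sub>E UNIV X \<subseteq> T"
    by auto
  define K where "K = {i. X i \<noteq> UNIV} \<inter> carrier G"
  have "finite K" "K \<subseteq> carrier G" using X(3) by (auto simp: K_def)
  have "\<exists>\<epsilon>>0. \<forall>g\<in>K. ball 1 \<epsilon> \<subseteq> X g"
    using \<open>finite K\<close> \<open>K \<subseteq> carrier G\<close>
  proof (induction K rule: finite_induct)
    case empty
    then show ?case by (auto intro: exI[of _ 1])
  next
    case (insert g K)
    then obtain \<epsilon> where \<epsilon>: "\<epsilon> > 0" "\<forall>g\<in>K. ball 1 \<epsilon> \<subseteq> X g" by auto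
    have "?e g \<in> X g" using X(1) by auto
    then have "1 \<in> X g"
      using insert.prems by (simp add: trivial_character_def)
    then obtain \<delta> where \<delta>: "\<delta> > 0" "ball 1 \<delta> \<subseteq> X g"
      using X(2)[of g] openE by blast
    have "ball 1 (min \<epsilon> \<delta>) \<subseteq> X h" if "h \<in> insert g K" for h
      using that \<epsilon>(2) \<delta>(2) by (auto simp: subset_iff)
    then show ?case using \<epsilon>(1) \<delta>(1) by (intro exI[of _ "min \<epsilon> \<delta>"]) simp
  qed
  then obtain \<epsilon> where \<epsilon>: "\<epsilon> > 0" "\<forall>g\<in>K. ball 1 \<epsilon> \<subseteq> X g" by blast
  have "\<epsilon>\<^sup>2 / 2 \<le> (\<Sum>g\<in>K. 1 - Re (\<xi> g))" if \<xi>: "\<xi> \<in> characters G" "\<xi> \<noteq> ?e" for \<xi>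
  proof -
    have tr: "\<xi> \<in> traces G" using \<xi> by (simp add: characters_def)
    then interpret group_trace G \<xi>
      using assms by (simp add: group_trace_def group_trace_axioms_def)
    have "\<xi> \<notin> Pi\<^sub>E UNIV X" using T(2) X(4) \<xi> by blast
    then obtain g where g: "\<xi> g \<notin> X g" by auto
    have "g \<in> carrier G"
    proof (rule ccontr)
      assume out: "g \<notin> carrier G"
      then have "\<xi> g = ?e g"
        using tr by (simp add: traces_def trivial_character_def extensional_def)
      moreover have "?e g \<in> X g" using X(1) by auto
      ultimately show False using g by simp
    qed
    then have "g \<in> K" using g by (auto simp: K_def)
    then have "\<xi> g \<notin> ball 1 \<epsilon>"
      using \<epsilon>(2) g by blast
    then have "\<epsilon> \<le> cmod (1 - \<xi> g)"
      by (simp add: dist_norm)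
    then have "\<epsilon>\<^sup>2 \<le> (cmod (1 - \<xi> g))\<^sup>2"
      using \<open>\<epsilon> > 0\<close> by (simp add: power_mono)
    also have "\<dots> = 1 - 2 * Re (\<xi> g) + (cmod (\<xi> g))\<^sup>2"
      by (simp add: cmod_power2 power2_diff)
    also have "\<dots> \<le> 2 * (1 - Re (\<xi> g))"
      using power_le_one[OF norm_ge_zero cmod_le_one[OF \<open>g \<in> carrier G\<close>], of 2] by simp
    finally have "\<epsilon>\<^sup>2 / 2 \<le> 1 - Re (\<xi> g)" by simp
    also have "\<dots> \<le> (\<Sum>g\<in>K. 1 - Re (\<xi> g))"
    proof (rule member_le_sum[OF \<open>g \<in> K\<close> _ \<open>finite K\<close>])
      fix h assume "h \<in> K - {g}"
      then show "0 \<le> 1 - Re (\<xi> h)"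
        using cmod_le_one[of h] complex_Re_le_cmod[of "\<xi> h"] \<open>K \<subseteq> carrier G\<close> by auto
    qed
    finally show ?thesis .
  qed
  then show ?thesis
    using that[of K "\<epsilon>\<^sup>2 / 2"] \<open>finite K\<close> \<open>K \<subseteq> carrier G\<close> \<open>\<epsilon> > 0\<close> by simp
qed

text \<open>For fixed points \<open>x\<^sub>i\<close> and coefficients \<open>c\<^sub>i\<close>, the difference \<open>A\<close> of the two sides of the inequality in \<open>trivial_part\<close>
  is a continuous affine function of the trace, so it suffices to see that it is non-negative at characters. At \<open>1\<close> it vanishes. At any
  other character the gap makes the left-hand side non-positive.\<close>

theorem ET_trivial_part:
  assumes "group G" and "property_ET G"
  obtains K \<kappa> where "finite K" and "K \<subseteq> carrier G" and "\<kappa> > 0"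
    and "\<forall>\<phi>\<in>traces G. trivial_part G (carrier G) \<phi> (1 - (\<Sum>g\<in>K. 1 - Re (\<phi> g)) / \<kappa>)"
proof -
  obtain K \<kappa> where K: "finite K" "K \<subseteq> carrier G" "\<kappa> > 0"
    and gap: "\<forall>\<xi>\<in>characters G. \<xi> \<noteq> trivial_character G \<longrightarrow> \<kappa> \<le> (\<Sum>g\<in>K. 1 - Re (\<xi> g))"
    using ET_uniform_gap[OF assms] .
  have "(1 - (\<Sum>g\<in>K. 1 - Re (\<phi> g)) / \<kappa>) * (cmod (\<Sum>i<n. c i))\<^sup>2
        \<le> Re (\<Sum>i<n. \<Sum>j<n. cnj (c i) * c j * \<phi> (inv\<^bsub>G\<^esub> x i \<otimes>\<^bsub>G\<^esub> x j))"
    if \<phi>: "\<phi> \<in> traces G" and x_in: "x \<in> {..<n} \<rightarrow> carrier G" for \<phi> and n :: nat and x c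
  proof -
    have x: "x i \<in> carrier G" if "i < n" for i using x_in that by auto
    interpret group G by fact
    define s where "s = (cmod (\<Sum>i<n. c i))\<^sup>2"
    define q where "q = (\<lambda>\<phi>. Re (\<Sum>i<n. \<Sum>j<n. cnj (c i) * c j * \<phi> (inv\<^bsub>G\<^esub> x i \<otimes>\<^bsub>G\<^esub> x j)))"
    define f where "f = (\<lambda>\<phi>::'a \<Rightarrow> complex. \<Sum>g\<in>K. 1 - Re (\<phi> g))"
    define A where "A = (\<lambda>\<phi>. q \<phi> + (s / \<kappa> * f \<phi> + - s))"
    have "affine_functional q"
      unfolding q_def Re_sum by (intro affine_sum affine_coordinate)
    moreover have "affine_functional (\<lambda>\<phi>::'a \<Rightarrow> complex. 1 - Re (\<phi> g))" for g
      using affine_add[OF affine_const[of 1] affine_cmult[OF affine_coordinate[of 1 g], of "- 1"]]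
      by simp
    then have "affine_functional f"
      unfolding f_def by (intro affine_sum)
    ultimately have A: "affine_functional A"
      unfolding A_def by (intro affine_add affine_cmult affine_const)
    have "traces G \<noteq> {}" using trivial_character_trace[OF assms(1)] by blast
    obtain \<xi> where \<xi>: "\<xi> \<in> traces G" "extreme_subset (traces G) {\<xi>}" and min: "\<forall>\<phi>\<in>traces G. A \<xi> \<le> A \<phi>"
      using affine_minimum_at_extreme_point[OF compact_traces[OF assms(1)] closed_traces
          \<open>traces G \<noteq> {}\<close> A] .
    have "0 \<le> A \<xi>"
    proof (cases "\<xi> = trivial_character G")
      case True
      have "q \<xi> = Re (\<Sum>i<n. \<Sum>j<n. cnj (c i) * c j)"
        unfolding q_def True by (intro arg_cong[of _ _ Re] sum.cong refl) (simp add: x trivial_character_def)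
      also have "(\<Sum>i<n. \<Sum>j<n. cnj (c i) * c j) = cnj (\<Sum>i<n. c i) * (\<Sum>i<n. c i)"
        by (simp add: sum_product)
      also have "\<dots> = of_real s"
        unfolding s_def by (metis complex_norm_square mult.commute)
      finally have "q \<xi> = s" by simp
      moreover have "f \<xi> = 0"
        using K(2) by (auto simp: f_def True trivial_character_def subset_iff intro!: sum.neutral)
      ultimately show ?thesis by (simp add: A_def)
    next
      case False
      then have "\<kappa> \<le> f \<xi>"
        using gap extreme_trace_is_character[OF \<xi>(2)] by (simp add: f_def)
      then have "s \<le> s / \<kappa> * f \<xi>"
        using \<open>\<kappa> > 0\<close> mult_left_mono[of \<kappa> "f \<xi>" s] by (simp add: s_def field_simps)
      moreover have "positive_definite G \<xi>" using \<xi> by (simp add: traces_def)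
      then have "0 \<le> q \<xi>"
        using x_in unfolding q_def positive_definite_def complex_nonneg_Reals_iff by blast
      ultimately show ?thesis by (simp add: A_def)
    qed
    also have "\<dots> \<le> A \<phi>" using min \<phi> by blast
    finally have "(1 - f \<phi> / \<kappa>) * s \<le> q \<phi>"
      by (simp add: A_def algebra_simps)
    then show ?thesis
      unfolding f_def s_def q_def .
  qed
  then show ?thesis using that[OF K] unfolding trivial_part_def by blast
qed

lemma trace_pullback:
  assumes "group H" and "group G" and "i \<in> hom H G" and \<phi>: "\<phi> \<in> traces G"
  shows "(\<lambda>h\<in>carrier H. \<phi> (i h)) \<in> traces H"
proof -
  interpret group_hom H G i
    using assms by (simp add: group_hom_def group_hom_axioms_def)
  have "positive_definite H (\<lambda>h\<in>carrier H. \<phi> (i h))"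
    unfolding positive_definite_def
  proof (intro allI impI)
    fix n :: nat and g and c :: "nat \<Rightarrow> complex"
    assume g: "g \<in> {..<n} \<rightarrow> carrier H"
    have "(\<Sum>k<n. \<Sum>j<n. cnj (c k) * c j * (\<lambda>h\<in>carrier H. \<phi> (i h)) (inv\<^bsub>H\<^esub> g k \<otimes>\<^bsub>H\<^esub> g j))
        = (\<Sum>k<n. \<Sum>j<n. cnj (c k) * c j * \<phi> (inv\<^bsub>G\<^esub> i (g k) \<otimes>\<^bsub>G\<^esub> i (g j)))"
      by (intro sum.cong refl) (use g in \<open>auto simp: Pi_iff\<close>)
    moreover have "(\<lambda>k. i (g k)) \<in> {..<n} \<rightarrow> carrier G"
      using g hom_closed by (auto simp: Pi_iff)
    ultimately show "(\<Sum>k<n. \<Sum>j<n. cnj (c k) * c j * (\<lambda>h\<in>carrier H. \<phi> (i h)) (inv\<^bsub>H\<^esub> g k \<otimes>\<^bsub>H\<^esub> g j)) \<in> \<real>\<^sub>\<ge>\<^sub>0"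
      using \<phi> by (simp add: traces_def positive_definite_def)
  qed
  then show ?thesis
    using \<phi> by (auto simp: traces_def)
qed

lemma trivial_part_of_image:
  assumes "group H" and "group G" and i: "i \<in> hom H G"
    and part: "trivial_part H (carrier H) (\<lambda>h\<in>carrier H. \<phi> (i h)) l"
  shows "trivial_part G (i ` carrier H) \<phi> l"
  unfolding trivial_part_def
proof (intro allI impI)
  interpret group_hom H G i
    using assms by (simp add: group_hom_def group_hom_axioms_def)
  fix n :: nat and x and c :: "nat \<Rightarrow> complex"
  assume "x \<in> {..<n} \<rightarrow> i ` carrier H"
  then have "\<forall>k. \<exists>y. k < n \<longrightarrow> y \<in> carrier H \<and> x k = i y" by blast
  then obtain y where y: "\<And>k. k < n \<Longrightarrow> y k \<in> carrier H" "\<And>k. k < n \<Longrightarrow> x k = i (y k)"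
    by metis
  have eq: "(\<Sum>k<n. \<Sum>j<n. cnj (c k) * c j * (\<lambda>h\<in>carrier H. \<phi> (i h)) (inv\<^bsub>H\<^esub> y k \<otimes>\<^bsub>H\<^esub> y j))
      = (\<Sum>k<n. \<Sum>j<n. cnj (c k) * c j * \<phi> (inv\<^bsub>G\<^esub> x k \<otimes>\<^bsub>G\<^esub> x j))"
    by (intro sum.cong refl) (simp add: y)
  have "y \<in> {..<n} \<rightarrow> carrier H" using y by simp
  then show "l * (cmod (\<Sum>k<n. c k))\<^sup>2
      \<le> Re (\<Sum>k<n. \<Sum>j<n. cnj (c k) * c j * \<phi> (inv\<^bsub>G\<^esub> x k \<otimes>\<^bsub>G\<^esub> x j))"
    using part unfolding trivial_part_def eq[symmetric] by blast
qed

text \<open>\<open>\<psi> = (\<xi> - \<epsilon>) / (1 - \<epsilon>)\<close> is a trace and \<open>\<xi> = (1 - \<epsilon>) \<psi> + \<epsilon>\<close>, so \<open>\<psi> = 1\<close> by extremality.\<close>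

lemma character_eq_trivial:
  assumes "group G" and \<xi>: "\<xi> \<in> characters G" and \<epsilon>: "0 < \<epsilon>" "\<epsilon> < 1"
    and part: "trivial_part G (carrier G) \<xi> \<epsilon>"
  shows "\<xi> = trivial_character (G :: ('a, 'm) monoid_scheme)"
proof -
  interpret group G by fact
  have tr: "\<xi> \<in> traces G" using \<xi> by (simp add: characters_def)
  define r where "r = 1 / (1 - \<epsilon>)"
  have r: "r > 0" "(1 - \<epsilon>) * r = 1"
    using \<epsilon> by (simp_all add: r_def)
  have cancel: "of_real (1 - \<epsilon>) * (of_real r * z) = z" for z :: complex
    using r(2) by (metis mult.assoc mult_1 of_real_1 of_real_mult)
  define \<psi> where "\<psi> = (\<lambda>g\<in>carrier G. of_real r * (\<xi> g - of_real \<epsilon>))"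
  have "positive_definite G \<psi>"
    unfolding positive_definite_def
  proof (intro allI impI)
    fix n :: nat and x and c :: "nat \<Rightarrow> complex"
    assume x: "x \<in> {..<n} \<rightarrow> carrier G"
    define q where "q = (\<Sum>i<n. \<Sum>j<n. cnj (c i) * c j * \<xi> (inv\<^bsub>G\<^esub> x i \<otimes>\<^bsub>G\<^esub> x j))"
    define s where "s = (cmod (\<Sum>i<n. c i))\<^sup>2"
    have "q \<in> \<real>\<^sub>\<ge>\<^sub>0"
      using tr x by (simp add: traces_def positive_definite_def q_def)
    then have q: "q = of_real (Re q)"
      by (simp add: complex_nonneg_Reals_iff complex_eq_iff)
    have s: "(\<Sum>i<n. \<Sum>j<n. cnj (c i) * c j) = of_real s"
    proof -
      have "(\<Sum>i<n. \<Sum>j<n. cnj (c i) * c j) = cnj (\<Sum>i<n. c i) * (\<Sum>i<n. c i)"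
        by (simp add: sum_product)
      then show ?thesis
        unfolding s_def by (metis complex_norm_square mult.commute)
    qed
    have "(\<Sum>i<n. \<Sum>j<n. cnj (c i) * c j * \<psi> (inv\<^bsub>G\<^esub> x i \<otimes>\<^bsub>G\<^esub> x j))
        = (\<Sum>i<n. \<Sum>j<n. of_real r *
            (cnj (c i) * c j * \<xi> (inv\<^bsub>G\<^esub> x i \<otimes>\<^bsub>G\<^esub> x j) - of_real \<epsilon> * (cnj (c i) * c j)))"
      by (intro sum.cong refl) (use x in \<open>auto simp: \<psi>_def Pi_iff algebra_simps\<close>)
    also have "\<dots> = of_real r * (q - of_real \<epsilon> * of_real s)"
      unfolding q_def s[symmetric] by (simp only: sum_distrib_left sum_subtractf right_diff_distrib)
    also have "\<dots> = of_real (r * (Re q - \<epsilon> * s))"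
      by (subst q) simp
    finally have eq: "(\<Sum>i<n. \<Sum>j<n. cnj (c i) * c j * \<psi> (inv\<^bsub>G\<^esub> x i \<otimes>\<^bsub>G\<^esub> x j))
        = of_real (r * (Re q - \<epsilon> * s))" .
    have "\<epsilon> * s \<le> Re q"
      using part x unfolding trivial_part_def q_def s_def by blast
    then have "0 \<le> r * (Re q - \<epsilon> * s)"
      using r(1) by simp
    then show "(\<Sum>i<n. \<Sum>j<n. cnj (c i) * c j * \<psi> (inv\<^bsub>G\<^esub> x i \<otimes>\<^bsub>G\<^esub> x j)) \<in> \<real>\<^sub>\<ge>\<^sub>0"
      unfolding eq by (simp only: nonneg_Reals_of_real_iff)
  qed
  moreover have "\<psi> \<one>\<^bsub>G\<^esub> = 1"
    using tr cancel[of 1] by (simp add: \<psi>_def traces_def algebra_simps)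
  ultimately have "\<psi> \<in> traces G"
    using tr by (auto simp: traces_def \<psi>_def)
  moreover have "\<forall>g\<in>carrier G. \<xi> g = of_real (1 - \<epsilon>) * \<psi> g + of_real \<epsilon> * trivial_character G g"
  proof
    fix g assume g: "g \<in> carrier G"
    then have "of_real (1 - \<epsilon>) * \<psi> g = \<xi> g - of_real \<epsilon>"
      by (simp only: \<psi>_def restrict_apply' cancel)
    then show "\<xi> g = of_real (1 - \<epsilon>) * \<psi> g + of_real \<epsilon> * trivial_character G g"
      using g by (simp only: trivial_character_def restrict_apply') simp
  qed
  ultimately have "\<psi> = trivial_character G"
    using \<xi> \<epsilon> trivial_character_trace[OF assms(1)] unfolding characters_def by blast
  then have "\<xi> g = 1" if "g \<in> carrier G" for g
    using \<open>\<forall>g\<in>carrier G. _\<close> that by (simp add: trivial_character_def)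
  then show ?thesis
    using tr by (auto simp: traces_def trivial_character_def extensional_def fun_eq_iff)
qed

text \<open>The neighbourhood of \<open>1\<close> is chosen such that the restrictions to both factors have trivial part larger
  than \<open>2/3\<close>, which makes the sum of the two trivial parts exceed \<open>1\<close>.\<close>

theorem ET_of_generated:
  fixes G :: "('g, 'k) monoid_scheme"
  assumes G1: "group G1" "property_ET G1" and G2: "group G2" "property_ET G2" and "group G"
    and i1: "i1 \<in> hom G1 G" and i2: "i2 \<in> hom G2 G"
    and gen: "\<forall>g\<in>carrier G. \<exists>xs. set xs \<subseteq> i1 ` carrier G1 \<union> i2 ` carrier G2
      \<and> g = foldr (\<otimes>\<^bsub>G\<^esub>) xs \<one>\<^bsub>G\<^esub>"
  shows "property_ET G"
proof -
  let ?e = "trivial_character G"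
  obtain K1 \<kappa>1 where K1: "finite K1" "K1 \<subseteq> carrier G1" "\<kappa>1 > 0"
    and part1: "\<forall>\<phi>\<in>traces G1. trivial_part G1 (carrier G1) \<phi> (1 - (\<Sum>g\<in>K1. 1 - Re (\<phi> g)) / \<kappa>1)"
    using ET_trivial_part[OF G1] .
  obtain K2 \<kappa>2 where K2: "finite K2" "K2 \<subseteq> carrier G2" "\<kappa>2 > 0"
    and part2: "\<forall>\<phi>\<in>traces G2. trivial_part G2 (carrier G2) \<phi> (1 - (\<Sum>g\<in>K2. 1 - Re (\<phi> g)) / \<kappa>2)"
    using ET_trivial_part[OF G2] .
  define T1 where "T1 = {\<phi> :: 'g \<Rightarrow> complex. (\<Sum>g\<in>K1. 1 - Re (\<phi> (i1 g))) < \<kappa>1 / 3}"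
  define T2 where "T2 = {\<phi> :: 'g \<Rightarrow> complex. (\<Sum>g\<in>K2. 1 - Re (\<phi> (i2 g))) < \<kappa>2 / 3}"
  have "open T1" "open T2"
    unfolding T1_def T2_def by (intro open_Collect_less continuous_intros; simp)+
  then have "open (T1 \<inter> T2)" by blast
  moreover have "?e \<in> T1 \<inter> T2"
  proof -
    have "(\<Sum>g\<in>K1. 1 - Re (?e (i1 g))) = 0" "(\<Sum>g\<in>K2. 1 - Re (?e (i2 g))) = 0"
      using K1(2) K2(2) i1 i2
      by (auto simp: trivial_character_def hom_in_carrier subset_iff intro!: sum.neutral)
    then show ?thesis using K1(3) K2(3) by (simp add: T1_def T2_def)
  qed
  moreover have "\<xi> = ?e" if \<xi>: "\<xi> \<in> T1 \<inter> T2" "\<xi> \<in> characters G" for \<xi>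
  proof -
    have tr: "\<xi> \<in> traces G" using \<xi> by (simp add: characters_def)
    interpret group_trace G \<xi>
      using \<open>group G\<close> tr by (simp add: group_trace_def group_trace_axioms_def)
    define l1 where "l1 = 1 - (\<Sum>g\<in>K1. 1 - Re ((\<lambda>h\<in>carrier G1. \<xi> (i1 h)) g)) / \<kappa>1"
    define l2 where "l2 = 1 - (\<Sum>g\<in>K2. 1 - Re ((\<lambda>h\<in>carrier G2. \<xi> (i2 h)) g)) / \<kappa>2"
    have sums: "(\<Sum>g\<in>K1. 1 - Re ((\<lambda>h\<in>carrier G1. \<xi> (i1 h)) g)) = (\<Sum>g\<in>K1. 1 - Re (\<xi> (i1 g)))"
      "(\<Sum>g\<in>K2. 1 - Re ((\<lambda>h\<in>carrier G2. \<xi> (i2 h)) g)) = (\<Sum>g\<in>K2. 1 - Re (\<xi> (i2 g)))"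
      using K1(2) K2(2) by (auto intro!: sum.cong)
    then have l: "l1 > 2/3" "l2 > 2/3"
      using \<xi>(1) K1(3) K2(3) by (simp_all add: l1_def l2_def T1_def T2_def field_simps)
    have t1: "trivial_part G (i1 ` carrier G1) \<xi> l1"
      using part1 trace_pullback[OF G1(1) \<open>group G\<close> i1 tr] unfolding l1_def
      by (intro trivial_part_of_image[OF G1(1) \<open>group G\<close> i1]) blast
    have t2: "trivial_part G (i2 ` carrier G2) \<xi> l2"
      using part2 trace_pullback[OF G2(1) \<open>group G\<close> i2 tr] unfolding l2_def
      by (intro trivial_part_of_image[OF G2(1) \<open>group G\<close> i2]) blast
    have sub: "subgroup (i1 ` carrier G1) G" "subgroup (i2 ` carrier G2) G"
      using G1(1) G2(1) \<open>group G\<close> i1 i2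
      by (simp_all add: group_hom.img_is_subgroup group_hom_def group_hom_axioms_def)
    have part: "trivial_part G (carrier G) \<xi> (((l1 + l2 - 1) / 2)\<^sup>2)"
      using l by (intro trivial_part_of_generated[OF sub t1 t2 _ gen]) simp
    have "Re (\<xi> g) \<le> 1" if "g \<in> carrier G" for g
      using cmod_le_one[OF that] complex_Re_le_cmod[of "\<xi> g"] by linarith
    then have "0 \<le> (\<Sum>g\<in>K1. 1 - Re (\<xi> (i1 g)))" "0 \<le> (\<Sum>g\<in>K2. 1 - Re (\<xi> (i2 g)))"
      using K1(2) K2(2) hom_in_carrier[OF i1] hom_in_carrier[OF i2]
      by (auto intro!: sum_nonneg)
    then have "l1 \<le> 1" "l2 \<le> 1"
      unfolding l1_def l2_def sums using K1(3) K2(3) by simp_all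
    then have "((l1 + l2 - 1) / 2)\<^sup>2 \<le> (1 / 2)\<^sup>2"
      using l by (intro power_mono) simp_all
    \<comment> \<open>The upper bound keeps the combination with \<open>1\<close> proper.\<close>
    then have "((l1 + l2 - 1) / 2)\<^sup>2 < 1" "0 < ((l1 + l2 - 1) / 2)\<^sup>2"
      using l by (simp_all add: power2_eq_square)
    then show ?thesis
      using part by (intro character_eq_trivial[OF \<open>group G\<close> \<xi>(2)])
  qed
  ultimately have "open (T1 \<inter> T2) \<and> (T1 \<inter> T2) \<inter> characters G = {?e}"
    using trivial_character_is_character[OF \<open>group G\<close>] by blast
  then show ?thesis
    unfolding property_ET_def isolated_in_def
    using trivial_character_is_character[OF \<open>group G\<close>] by blast
qed

section \<open>Amalgamated products are generated by their factors\<close>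

locale free_product_of_groups = G1: group G1 + G2: group G2
  for G1 :: "('a, 'm) monoid_scheme" and G2 :: "('b, 'n) monoid_scheme"
begin

abbreviation "W \<equiv> fp_words G1 G2"
abbreviation "E \<equiv> fp_rel G1 G2"
abbreviation "P \<equiv> free_product G1 G2"

definition word_class :: "('a + 'b) list \<Rightarrow> ('a + 'b) list set" where
  "word_class u = E `` {u}"

lemma words_append [simp]: "u @ v \<in> W \<longleftrightarrow> u \<in> W \<and> v \<in> W"
  by (auto simp: fp_words_def)

lemma words_Nil [simp]: "[] \<in> W"
  by (simp add: fp_words_def)

lemma words_Cons [simp]:
  "Inl x # u \<in> W \<longleftrightarrow> x \<in> carrier G1 \<and> u \<in> W"
  "Inr y # u \<in> W \<longleftrightarrow> y \<in> carrier G2 \<and> u \<in> W"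
  by (auto simp: fp_words_def)

lemma equiv_fp_rel: "equiv W E"
proof (rule equivI)
  show "E \<subseteq> W \<times> W" by (auto simp: fp_rel_def)
  show "refl_on W E" by (auto simp: fp_rel_def refl_on_def)
  show "sym E" by (auto simp: fp_rel_def intro!: symI intro: equivclp_sym)
  show "trans E" by (auto simp: fp_rel_def intro!: transI intro: equivclp_trans)
qed

lemma fp_step_context:
  assumes "fp_step G1 G2 u v"
  shows "fp_step G1 G2 (a @ u @ b) (a @ v @ b)"
  using assms
proof cases
  case (one_left u v)
  then show ?thesis using fp_step.one_left[of G1 G2 "a @ u" "v @ b"] by simp
next
  case (one_right u v)
  then show ?thesis using fp_step.one_right[of G1 G2 "a @ u" "v @ b"] by simp
next
  case (mult_left x y u v)
  then show ?thesis using fp_step.mult_left[of x G1 y G2 "a @ u" "v @ b"] by simp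
next
  case (mult_right x y u v)
  then show ?thesis using fp_step.mult_right[of x G2 y G1 "a @ u" "v @ b"] by simp
qed

text \<open>The generating steps may be carried out inside any word. This makes concatenation of words
  well defined on classes.\<close>

lemma fp_rel_context:
  assumes "(u, v) \<in> E" and ab: "a \<in> W" "b \<in> W"
  shows "(a @ u @ b, a @ v @ b) \<in> E"
proof -
  let ?R = "\<lambda>u v. u \<in> W \<and> v \<in> W \<and> fp_step G1 G2 u v"
  have uv: "u \<in> W" "v \<in> W" "equivclp ?R u v"
    using assms(1) by (auto simp: fp_rel_def)
  from uv(3) have "equivclp ?R (a @ u @ b) (a @ v @ b)"
  proof (induction rule: equivclp_induct)
    case base
    then show ?case by simp
  next
    case (step y z)
    then have "?R (a @ y @ b) (a @ z @ b) \<or> ?R (a @ z @ b) (a @ y @ b)"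
      using ab fp_step_context by auto
    then have "equivclp ?R (a @ y @ b) (a @ z @ b)"
      using r_into_equivclp[of ?R "a @ y @ b" "a @ z @ b"]
        r_into_equivclp[of ?R "a @ z @ b" "a @ y @ b"] equivclp_sym[of ?R] by blast
    then show ?case
      by (rule equivclp_trans[OF step.IH])
  qed
  then show ?thesis
    using uv ab by (simp add: fp_rel_def)
qed

lemma class_eqI:
  assumes "fp_step G1 G2 u v" and "u \<in> W" and "v \<in> W"
  shows "word_class u = word_class v"
proof -
  have "(u, v) \<in> E"
    using assms by (simp add: fp_rel_def r_into_equivclp)
  then show ?thesis
    unfolding word_class_def by (rule equiv_class_eq[OF equiv_fp_rel])
qed

lemma carrier_P: "carrier P = word_class ` W"
  by (auto simp: free_product_def word_class_def quotient_def)

lemma one_P: "\<one>\<^bsub>P\<^esub> = word_class []"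
  by (simp add: free_product_def word_class_def)

lemma mult_P:
  assumes "u \<in> W" and "v \<in> W"
  shows "word_class u \<otimes>\<^bsub>P\<^esub> word_class v = word_class (u @ v)"
proof -
  have "word_class (u' @ v') = word_class (u @ v)" if "u' \<in> word_class u" "v' \<in> word_class v" for u' v'
  proof -
    have uv: "(u, u') \<in> E" "(v, v') \<in> E" using that by (auto simp: word_class_def)
    then have "u' \<in> W" by (auto simp: fp_rel_def)
    have "(u @ v, u' @ v) \<in> E"
      using fp_rel_context[OF uv(1), of "[]" v] assms by simp
    moreover have "(u' @ v, u' @ v') \<in> E"
      using fp_rel_context[OF uv(2), of u' "[]"] \<open>u' \<in> W\<close> by simp
    ultimately have "(u @ v, u' @ v') \<in> E"
      using equiv_fp_rel by (meson equivE transE)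
    then show ?thesis
      unfolding word_class_def by (rule equiv_class_eq[OF equiv_fp_rel, symmetric])
  qed
  moreover have "u \<in> word_class u" "v \<in> word_class v"
    unfolding word_class_def using assms equiv_class_self[OF equiv_fp_rel] by blast+
  ultimately have "(\<Union>u'\<in>word_class u. \<Union>v'\<in>word_class v. word_class (u' @ v')) = word_class (u @ v)"
    by blast
  then show ?thesis
    by (simp add: free_product_def word_class_def)
qed

lemma merge_left:
  "x \<in> carrier G1 \<Longrightarrow> y \<in> carrier G1 \<Longrightarrow> word_class [Inl x, Inl y] = word_class [Inl (x \<otimes>\<^bsub>G1\<^esub> y)]"
  using fp_step.mult_left[of x G1 y G2 "[]" "[]"] by (intro class_eqI) auto

lemma merge_right:
  "x \<in> carrier G2 \<Longrightarrow> y \<in> carrier G2 \<Longrightarrow> word_class [Inr x, Inr y] = word_class [Inr (x \<otimes>\<^bsub>G2\<^esub> y)]"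
  using fp_step.mult_right[of x G2 y G1 "[]" "[]"] by (intro class_eqI) auto

lemma delete_one:
  "word_class [Inl \<one>\<^bsub>G1\<^esub>] = word_class []" "word_class [Inr \<one>\<^bsub>G2\<^esub>] = word_class []"
proof -
  show "word_class [Inl \<one>\<^bsub>G1\<^esub>] = word_class []"
    using fp_step.one_left[of G1 G2 "[]" "[]"] by (intro class_eqI) simp_all
  show "word_class [Inr \<one>\<^bsub>G2\<^esub>] = word_class []"
    using fp_step.one_right[of G1 G2 "[]" "[]"] by (intro class_eqI) simp_all
qed

text \<open>The inverse letters in reverse order cancel from the inside out.\<close>

lemma left_inverse_word: "u \<in> W \<Longrightarrow> \<exists>v\<in>W. word_class (v @ u) = word_class []"
proof (induction u)
  case Nil
  then show ?case by (intro bexI[of _ "[]"]) simp_all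
next
  case (Cons l u)
  have "u \<in> W" "[l] \<in> W" using Cons.prems by (auto simp: fp_words_def)
  then obtain v where v: "v \<in> W" "word_class (v @ u) = word_class []"
    using Cons.IH by blast
  have "\<exists>l'. [l'] \<in> W \<and> word_class [l', l] = word_class []"
  proof (cases l)
    case (Inl x)
    then have "x \<in> carrier G1" using \<open>[l] \<in> W\<close> by simp
    then show ?thesis
      using Inl merge_left[of "inv\<^bsub>G1\<^esub> x" x] delete_one by (intro exI[of _ "Inl (inv\<^bsub>G1\<^esub> x)"]) simp
  next
    case (Inr x)
    then have "x \<in> carrier G2" using \<open>[l] \<in> W\<close> by simp
    then show ?thesis
      using Inr merge_right[of "inv\<^bsub>G2\<^esub> x" x] delete_one by (intro exI[of _ "Inr (inv\<^bsub>G2\<^esub> x)"]) simp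
  qed
  then obtain l' where l': "[l'] \<in> W" "word_class [l', l] = word_class []" by blast
  have "word_class ((v @ [l']) @ (l # u)) = word_class v \<otimes>\<^bsub>P\<^esub> word_class [l', l] \<otimes>\<^bsub>P\<^esub> word_class u"
    using v \<open>u \<in> W\<close> \<open>[l] \<in> W\<close> l'(1) by (simp add: mult_P words_append[of "[l']" "[l]", simplified])
  also have "\<dots> = word_class (v @ u)"
    using v \<open>u \<in> W\<close> l'(2) by (simp add: mult_P)
  finally show ?case
    using v l'(1) by (intro bexI[of _ "v @ [l']"]) simp_all
qed

lemma group_P: "group P"
proof (rule groupI)
  show "\<one>\<^bsub>P\<^esub> \<in> carrier P" by (simp add: one_P carrier_P)
  fix x assume "x \<in> carrier P"
  then obtain u where u: "u \<in> W" "x = word_class u" by (auto simp: carrier_P)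
  show "\<one>\<^bsub>P\<^esub> \<otimes>\<^bsub>P\<^esub> x = x" using u by (simp add: one_P mult_P)
  obtain v where "v \<in> W" "word_class (v @ u) = word_class []"
    using left_inverse_word[OF u(1)] by blast
  then show "\<exists>y\<in>carrier P. y \<otimes>\<^bsub>P\<^esub> x = \<one>\<^bsub>P\<^esub>"
    using u by (intro bexI[of _ "word_class v"]) (simp_all add: one_P carrier_P mult_P)
  fix y assume "y \<in> carrier P"
  then obtain v where v: "v \<in> W" "y = word_class v" by (auto simp: carrier_P)
  show "x \<otimes>\<^bsub>P\<^esub> y \<in> carrier P" using u v by (simp add: mult_P carrier_P)
  fix z assume "z \<in> carrier P"
  then obtain w where "w \<in> W" "z = word_class w" by (auto simp: carrier_P)
  then show "x \<otimes>\<^bsub>P\<^esub> y \<otimes>\<^bsub>P\<^esub> z = x \<otimes>\<^bsub>P\<^esub> (y \<otimes>\<^bsub>P\<^esub> z)"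
    using u v by (simp add: mult_P)
qed

lemma fp_left_hom: "fp_left G1 G2 \<in> hom G1 P"
  unfolding hom_def fp_left_def word_class_def[symmetric]
  by (auto simp: carrier_P mult_P merge_left)

lemma fp_right_hom: "fp_right G1 G2 \<in> hom G2 P"
  unfolding hom_def fp_right_def word_class_def[symmetric]
  by (auto simp: carrier_P mult_P merge_right)

lemma generated_by_factors:
  assumes "x \<in> carrier P"
  obtains xs where "set xs \<subseteq> fp_left G1 G2 ` carrier G1 \<union> fp_right G1 G2 ` carrier G2"
    and "x = foldr (\<otimes>\<^bsub>P\<^esub>) xs \<one>\<^bsub>P\<^esub>"
proof -
  obtain u where u: "u \<in> W" "x = word_class u" using assms by (auto simp: carrier_P)
  have letter: "word_class [l] \<in> fp_left G1 G2 ` carrier G1 \<union> fp_right G1 G2 ` carrier G2"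
    if "[l] \<in> W" for l
    using that by (cases l) (auto simp: fp_left_def fp_right_def word_class_def)
  have "set (map (\<lambda>l. word_class [l]) u) \<subseteq> fp_left G1 G2 ` carrier G1 \<union> fp_right G1 G2 ` carrier G2
      \<and> word_class u = foldr (\<otimes>\<^bsub>P\<^esub>) (map (\<lambda>l. word_class [l]) u) \<one>\<^bsub>P\<^esub>"
    using u(1)
  proof (induction u)
    case Nil
    then show ?case by (simp add: one_P)
  next
    case (Cons l u)
    have lu: "[l] \<in> W" "u \<in> W" using Cons.prems by (auto simp: fp_words_def)
    have "word_class (l # u) = word_class [l] \<otimes>\<^bsub>P\<^esub> word_class u"
      using mult_P[OF lu] by simp
    then show ?case
      using Cons.IH[OF lu(2)] letter[OF lu(1)] by simp
  qed
  then show ?thesis using that u(2) by blast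
qed

end

lemma (in group) normal_closure_normal:
  assumes "S \<subseteq> carrier G"
  shows "normal_closure G S \<lhd> G"
proof -
  let ?F = "{N. N \<lhd> G \<and> S \<subseteq> N}"
  have "carrier G \<lhd> G"
    by (simp add: normal_inv_iff subgroup_self)
  then have "carrier G \<in> ?F" using assms by simp
  have "subgroup (\<Inter>?F) G"
    using \<open>carrier G \<in> ?F\<close> normal_imp_subgroup by (intro subgroups_Inter) auto
  then have "\<Inter>?F \<lhd> G"
    unfolding normal_inv_iff[of "\<Inter>?F"] by (auto simp: normal_inv_iff)
  then show ?thesis
    by (simp add: normal_closure_def hull_def)
qed

text \<open>The maps from the factors into the free product, followed by the quotient map. Words in the letters of the
  factors represent all elements.\<close>

theorem amalgamated_product_generated:
  assumes "group G1" and "group G2"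
    and f1: "f1 \<in> hom H G1" and f2: "f2 \<in> hom H G2"
  obtains i1 i2 where "group (amalgamated_product G1 G2 H f1 f2)"
    and "i1 \<in> hom G1 (amalgamated_product G1 G2 H f1 f2)"
    and "i2 \<in> hom G2 (amalgamated_product G1 G2 H f1 f2)"
    and "\<forall>g\<in>carrier (amalgamated_product G1 G2 H f1 f2).
      \<exists>xs. set xs \<subseteq> i1 ` carrier G1 \<union> i2 ` carrier G2
        \<and> g = foldr (\<otimes>\<^bsub>amalgamated_product G1 G2 H f1 f2\<^esub>) xs \<one>\<^bsub>amalgamated_product G1 G2 H f1 f2\<^esub>"
proof -
  interpret free_product_of_groups G1 G2
    using assms by (simp add: free_product_of_groups_def)
  interpret P: group P by (rule group_P)
  let ?S = "(\<lambda>h. fp_left G1 G2 (f1 h) \<otimes>\<^bsub>P\<^esub> inv\<^bsub>P\<^esub> fp_right G1 G2 (f2 h)) ` carrier H"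
  define N where "N = normal_closure P ?S"
  define A where "A = amalgamated_product G1 G2 H f1 f2"
  have A: "A = P Mod N"
    by (simp add: A_def N_def amalgamated_product_def Let_def)
  have "?S \<subseteq> carrier P"
    using f1 f2 hom_in_carrier[OF fp_left_hom] hom_in_carrier[OF fp_right_hom]
    by (auto simp: hom_in_carrier)
  then interpret N: normal N P
    unfolding N_def by (rule P.normal_closure_normal)
  have grp: "group A" unfolding A by (rule N.factorgroup_is_group)
  let ?\<pi> = "\<lambda>a. N #>\<^bsub>P\<^esub> a"
  have \<pi>: "?\<pi> \<in> hom P A" unfolding A by (rule N.r_coset_hom_Mod)
  have \<pi>_one: "?\<pi> \<one>\<^bsub>P\<^esub> = \<one>\<^bsub>A\<^esub>"
    using \<pi> P.is_group grp by (rule hom_one)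
  let ?i1 = "?\<pi> \<circ> fp_left G1 G2" and ?i2 = "?\<pi> \<circ> fp_right G1 G2"
  have "\<exists>xs. set xs \<subseteq> ?i1 ` carrier G1 \<union> ?i2 ` carrier G2 \<and> g = foldr (\<otimes>\<^bsub>A\<^esub>) xs \<one>\<^bsub>A\<^esub>"
    if "g \<in> carrier A" for g
  proof -
    have "g \<in> ?\<pi> ` carrier P"
      using that unfolding A carrier_FactGroup .
    then obtain x where x: "g = ?\<pi> x" "x \<in> carrier P"
      by (rule imageE)
    obtain xs where xs: "set xs \<subseteq> fp_left G1 G2 ` carrier G1 \<union> fp_right G1 G2 ` carrier G2"
        "x = foldr (\<otimes>\<^bsub>P\<^esub>) xs \<one>\<^bsub>P\<^esub>"
      using generated_by_factors[OF x(2)] .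
    have in_P: "set xs \<subseteq> carrier P"
      using xs(1) hom_in_carrier[OF fp_left_hom] hom_in_carrier[OF fp_right_hom] by auto
    have "foldr (\<otimes>\<^bsub>P\<^esub>) ys \<one>\<^bsub>P\<^esub> \<in> carrier P \<and>
        ?\<pi> (foldr (\<otimes>\<^bsub>P\<^esub>) ys \<one>\<^bsub>P\<^esub>) = foldr (\<otimes>\<^bsub>A\<^esub>) (map ?\<pi> ys) \<one>\<^bsub>A\<^esub>"
      if "set ys \<subseteq> carrier P" for ys
      using that
    proof (induction ys)
      case Nil
      then show ?case using \<pi>_one by simp
    next
      case (Cons y ys)
      then show ?case using hom_mult[OF \<pi>, of y] by simp
    qed
    then have "g = foldr (\<otimes>\<^bsub>A\<^esub>) (map ?\<pi> xs) \<one>\<^bsub>A\<^esub>"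
      using x(1) xs(2) in_P by simp
    moreover have "set (map ?\<pi> xs) \<subseteq> ?i1 ` carrier G1 \<union> ?i2 ` carrier G2"
      using xs(1) by auto
    ultimately show ?thesis by blast
  qed
  moreover have "?i1 \<in> hom G1 A" "?i2 \<in> hom G2 A"
    using hom_compose[OF fp_left_hom \<pi>] hom_compose[OF fp_right_hom \<pi>] by simp_all
  ultimately show ?thesis
    using that[of ?i1 ?i2] grp unfolding A_def by blast
qed


section \<open>Property (ET) for amalgamated products\<close>

theorem corollary7p5:
  fixes G1 :: "('a, 'm) monoid_scheme"
    and G2 :: "('b, 'n) monoid_scheme"
    and H :: "('c, 'k) monoid_scheme"
    and f1 :: "'c \<Rightarrow> 'a" and f2 :: "'c \<Rightarrow> 'b"
  assumes "group G1" and "group G2" and "group H"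
    and "f1 \<in> hom H G1" and "f2 \<in> hom H G2"
    and "property_ET G1" and "property_ET G2"
  shows "property_ET (amalgamated_product G1 G2 H f1 f2)"
proof -
  let ?A = "amalgamated_product G1 G2 H f1 f2"
  obtain i1 i2 where A: "group ?A" "i1 \<in> hom G1 ?A" "i2 \<in> hom G2 ?A"
    "\<forall>g\<in>carrier ?A. \<exists>xs. set xs \<subseteq> i1 ` carrier G1 \<union> i2 ` carrier G2
      \<and> g = foldr (\<otimes>\<^bsub>?A\<^esub>) xs \<one>\<^bsub>?A\<^esub>"
    by (rule amalgamated_product_generated[OF assms(1,2,4,5)])
  show ?thesis
    by (rule ET_of_generated[OF assms(1,6,2,7) A])
qed

end
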